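(* Let $M$ be an ACI-matrix over a field $\mathbb{F}$. Then there exist a nonsingular constant matrix $R$ and a permutation matrix $Q$ such that $$RMQ=\begin{bmatrix} \mathbf{W} & * & *\\ 0 & \mathbf{S} & *\\ 0 & 0 & \mathbf{T}\end{bmatrix},$$ where $\mathbf{W}$ is a wide FmR ACI-matrix or void, $\mathbf{S}$ is a square FmR ACI-matrix or void, and $\mathbf{T}$ is a tall FmR ACI-matrix or void (the entries marked $*$ are unrestricted blocks). Moreover, if $\mathbf{S}$ is required to be as large as possible among all such decompositions of $M$, then $\mathbf{W}$, $\mathbf{S}$ and $\mathbf{T}$ are unique up to equivalence.
   Context: Let $\mathbb{F}$ be a field. An ACI-matrix is a matrix with entries in $\mathbb{F}[x_1,\dots,x_k]$ whose entries are polynomials of degree at most one and such that no indeterminate appears in two different columns. A completion is an assignment of values in $\mathbb{F}$ to all indeterminates; $\mathrm{maxRank}(N)$ is the maximum rank of a completion. Two ACI-matrices satisfy $N\sim N'$ (equivalent) if $N'=RNQ$ with $R$ a nonsingular constant matrix over $\mathbb{F}$ and $Q$ a permutation matrix. $N$ is wide if it has more columns than rows, tall if more rows than columns, square if equal. ACI-matrices (and blocks) of size $0\times q$ ($q>0$, wide degenerate, counted as wide), $p\times 0$ ($p>0$, tall degenerate, counted as tall) and $0\times0$ (void) are allowed. $N$ is FmR if $\mathrm{maxRank}(N)=\min\{\mathrm{rows}(N),\mathrm{cols}(N)\}$ (so degenerate ACI-matrices are FmR). *)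

theory Defs
  imports "Jordan_Normal_Form.DL_Rank"
begin

text \<open>An ACI-matrix with entries in F[x_0,...,x_(k-1)] of degree at most one is represented
  as a pair (C, A): the constant part C and, for each indeterminate v < k, the coefficient
  matrix A v, so that the matrix is C + sum_(v<k) x_v A v.\<close>

type_synonym 'a aci = "'a mat \<times> (nat \<Rightarrow> 'a mat)"

definition aci_rows :: "'a aci \<Rightarrow> nat" where
  "aci_rows M = dim_row (fst M)"

definition aci_cols :: "'a aci \<Rightarrow> nat" where
  "aci_cols M = dim_col (fst M)"

definition is_aci :: "nat \<Rightarrow> 'a::field aci \<Rightarrow> bool" where
  "is_aci k M \<longleftrightarrow>
     (\<forall>v<k. snd M v \<in> carrier_mat (aci_rows M) (aci_cols M)) \<and>
     (\<forall>v<k. \<exists>j. \<forall>i l. i < aci_rows M \<longrightarrow> l < aci_cols M \<longrightarrow> snd M v $$ (i, l) \<noteq> 0 \<longrightarrow> l = j)"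

definition completion :: "nat \<Rightarrow> 'a::field aci \<Rightarrow> (nat \<Rightarrow> 'a) \<Rightarrow> 'a mat" where
  "completion k M a = mat (aci_rows M) (aci_cols M)
      (\<lambda>(i, j). fst M $$ (i, j) + (\<Sum>v<k. a v * snd M v $$ (i, j)))"

definition mat_rank :: "'a::field mat \<Rightarrow> nat" where
  "mat_rank A = vec_space.rank (dim_row A) A"

definition maxRank :: "nat \<Rightarrow> 'a::field aci \<Rightarrow> nat" where
  "maxRank k M = Max {mat_rank (completion k M a) | a. True}"

definition FmR :: "nat \<Rightarrow> 'a::field aci \<Rightarrow> bool" where
  "FmR k M \<longleftrightarrow> maxRank k M = min (aci_rows M) (aci_cols M)"

text \<open>Shape predicates (degenerate sizes allowed; void = 0 x 0).\<close>
definition wide_or_void :: "'a aci \<Rightarrow> bool" where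
  "wide_or_void M \<longleftrightarrow> aci_rows M < aci_cols M \<or> (aci_rows M = 0 \<and> aci_cols M = 0)"

definition square_or_void :: "'a aci \<Rightarrow> bool" where
  "square_or_void M \<longleftrightarrow> aci_rows M = aci_cols M"

definition tall_or_void :: "'a aci \<Rightarrow> bool" where
  "tall_or_void M \<longleftrightarrow> aci_rows M > aci_cols M \<or> (aci_rows M = 0 \<and> aci_cols M = 0)"

text \<open>Permutation matrix of a permutation p of {..<n}: column j is the unit vector e_(p j),
  so (M * perm_mat n p) has as j-th column the (p j)-th column of M.\<close>
definition perm_mat :: "nat \<Rightarrow> (nat \<Rightarrow> nat) \<Rightarrow> 'a::field mat" where
  "perm_mat n p = mat n n (\<lambda>(i, j). if i = p j then 1 else 0)"

definition is_perm_mat :: "nat \<Rightarrow> 'a::field mat \<Rightarrow> bool" where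
  "is_perm_mat n Q \<longleftrightarrow> (\<exists>p. p permutes {..<n} \<and> Q = perm_mat n p)"

definition aci_mult :: "'a::field mat \<Rightarrow> 'a aci \<Rightarrow> 'a mat \<Rightarrow> 'a aci" where
  "aci_mult R M Q = (R * fst M * Q, \<lambda>v. R * snd M v * Q)"

definition aci_equiv :: "nat \<Rightarrow> 'a::field aci \<Rightarrow> 'a aci \<Rightarrow> bool" where
  "aci_equiv k N N' \<longleftrightarrow>
     (\<exists>R Q. R \<in> carrier_mat (aci_rows N) (aci_rows N) \<and> invertible_mat R \<and>
            is_perm_mat (aci_cols N) Q \<and>
            aci_rows N' = aci_rows N \<and> aci_cols N' = aci_cols N \<and>
            (\<forall>v<k. snd N' v = snd (aci_mult R N Q) v) \<and> fst N' = fst (aci_mult R N Q))"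

definition aci_block :: "'a aci \<Rightarrow> nat \<Rightarrow> nat \<Rightarrow> nat \<Rightarrow> nat \<Rightarrow> 'a aci" where
  "aci_block M r0 r1 c0 c1 =
     (mat (r1 - r0) (c1 - c0) (\<lambda>(i, j). fst M $$ (i + r0, j + c0)),
      \<lambda>v. mat (r1 - r0) (c1 - c0) (\<lambda>(i, j). snd M v $$ (i + r0, j + c0)))"

definition aci_zero :: "nat \<Rightarrow> 'a::field aci \<Rightarrow> bool" where
  "aci_zero k M \<longleftrightarrow> (\<forall>i<aci_rows M. \<forall>j<aci_cols M.
       fst M $$ (i, j) = 0 \<and> (\<forall>v<k. snd M v $$ (i, j) = 0))"

definition block_decomp ::
  "nat \<Rightarrow> 'a::field aci \<Rightarrow> 'a mat \<Rightarrow> 'a mat \<Rightarrow> nat \<Rightarrow> nat \<Rightarrow> nat \<Rightarrow> nat \<Rightarrow> nat \<Rightarrow> nat \<Rightarrow> bool" where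
  "block_decomp k M R Q r1 r2 r3 c1 c2 c3 \<longleftrightarrow>
     (let m = aci_rows M; n = aci_cols M; N = aci_mult R M Q in
      R \<in> carrier_mat m m \<and> invertible_mat R \<and> is_perm_mat n Q \<and>
      r1 + r2 + r3 = m \<and> c1 + c2 + c3 = n \<and>
      (let W = aci_block N 0 r1 0 c1;
           S = aci_block N r1 (r1 + r2) c1 (c1 + c2);
           T = aci_block N (r1 + r2) m (c1 + c2) n in
       wide_or_void W \<and> FmR k W \<and>
       square_or_void S \<and> FmR k S \<and>
       tall_or_void T \<and> FmR k T \<and>
       aci_zero k (aci_block N r1 m 0 c1) \<and>
       aci_zero k (aci_block N (r1 + r2) m c1 (c1 + c2))))"

definition decomp_W :: "'a::field aci \<Rightarrow> 'a mat \<Rightarrow> 'a mat \<Rightarrow> nat \<Rightarrow> nat \<Rightarrow> 'a aci" where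
  "decomp_W M R Q r1 c1 = aci_block (aci_mult R M Q) 0 r1 0 c1"

definition decomp_S :: "'a::field aci \<Rightarrow> 'a mat \<Rightarrow> 'a mat \<Rightarrow> nat \<Rightarrow> nat \<Rightarrow> nat \<Rightarrow> nat \<Rightarrow> 'a aci" where
  "decomp_S M R Q r1 r2 c1 c2 = aci_block (aci_mult R M Q) r1 (r1 + r2) c1 (c1 + c2)"

definition decomp_T :: "'a::field aci \<Rightarrow> 'a mat \<Rightarrow> 'a mat \<Rightarrow> nat \<Rightarrow> nat \<Rightarrow> 'a aci" where
  "decomp_T M R Q r12 c12 = aci_block (aci_mult R M Q) r12 (aci_rows M) c12 (aci_cols M)"

end

theory Submission
  imports Defs "HOL-Library.Function_Algebras"
begin

text \<open>Let \<open>A j\<close> be the set of all values of the \<open>j\<close>-th column and \<open>f J\<close> the dimension of the span of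
  \<open>\<Union>j\<in>J. A j\<close>. Columns can be completed independently of each other, so Rado's theorem with defect
  yields a completion of rank \<open>n + min\<^sub>J (f J - |J|)\<close>. The function \<open>f J - |J|\<close> is submodular, and the
  decompositions of \<open>M\<close> correspond to chains \<open>J1 \<subseteq> J2\<close> of its minimisers (columns of \<open>W\<close>, columns of \<open>W\<close>
  and \<open>S\<close>), up to the shape conditions: one completion of maximal rank shows that all three diagonal
  blocks are FmR. Minimisers are closed under intersection and union, so a chain with \<open>|J2| - |J1|\<close>
  maximal is unique. Two decompositions with the same chain differ by a change of basis that preserves
  the spans of the columns in \<open>J1\<close> and \<open>J2\<close>, hence is block triangular with invertible diagonal blocks.\<close>

section \<open>Dimension in vector spaces and Rado's theorem\<close>

text \<open>Rado's theorem stands in for a genericity argument: it picks actual vectors out of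
  arbitrary nonempty sets, so nothing is assumed about the size of the field. The sets
  \<open>A j\<close> are affine and in general no subspaces; they enter only through the dimensions
  of spans. Let \<open>d\<close> be the maximum of \<open>|J| - f J\<close>. If \<open>J1\<close> is
  a minimiser, \<open>W\<close> has \<open>f J1\<close> rows and \<open>f J1 + d\<close> columns.
  Between two minimisers rows and columns grow by the same amount, which is why \<open>S\<close> is
  square. \<open>T\<close> has \<open>m - f J2\<close> rows and \<open>n - |J2|\<close> columns,
  hence \<open>m + d - n\<close> more rows than columns for every minimiser \<open>J2\<close>. So
  the shapes depend on \<open>d\<close> rather than on the chain, with two exceptions:
  \<open>d = 0\<close> forces \<open>J1 = {}\<close>, because \<open>W\<close> must not be square
  unless void, and \<open>n = m + d\<close> forces \<open>J2\<close> to contain all columns, because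
  then \<open>T\<close> must be void. The first condition survives intersections and the second
  survives unions. This is why two chains are merged by intersecting their lower and uniting their
  upper members, the choice that also enlarges \<open>S\<close>.\<close>

text \<open>A separate locale, because inside \<open>vector_space\<close> new names are shadowed by their instances for
  \<open>real_vector\<close>.\<close>

locale linear_families = vector_space scale
  for scale :: "'a::field \<Rightarrow> 'b::ab_group_add \<Rightarrow> 'b" (infixr \<open>*s\<close> 75)
begin

lemma finite_basis_extend:
  assumes "finite E" "V \<subseteq> span E" "S \<subseteq> V" "independent S"
  shows "\<exists>B. S \<subseteq> B \<and> B \<subseteq> V \<and> independent B \<and> V \<subseteq> span B \<and> finite B \<and> card B = dim V"
proof -
  obtain B where B: "S \<subseteq> B" "B \<subseteq> V" "independent B" "V \<subseteq> span B"
    using maximal_independent_subset_extend[OF assms(3,4)] by blast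
  moreover have "finite B" using independent_span_bound[OF assms(1) B(3)] B(2) assms(2) by blast
  moreover have "card B = dim V" using basis_card_eq_dim B by blast
  ultimately show ?thesis by blast
qed

lemma card_le_dim:
  assumes "finite E" "V \<subseteq> span E" "S \<subseteq> V" "independent S"
  shows "card S \<le> dim V"
proof -
  obtain B where "S \<subseteq> B" "finite B" "card B = dim V"
    using finite_basis_extend[OF assms] by blast
  then show ?thesis using card_mono by metis
qed

lemma dim_mono_finite:
  assumes "finite E" "Y \<subseteq> span E" "X \<subseteq> span Y"
  shows "dim X \<le> dim Y"
proof -
  obtain B where B: "Y \<subseteq> span B" "finite B" "card B = dim Y"
    using finite_basis_extend[OF assms(1,2) empty_subsetI independent_empty] by blast
  then have "X \<subseteq> span B" using assms(3) span_minimal[OF B(1) subspace_span] by blast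
  then show ?thesis using dim_le_card B by metis
qed

lemma subset_span_if_dim_le:
  assumes "finite E" "V \<subseteq> span E" "X \<subseteq> V" "dim V \<le> dim X"
  shows "V \<subseteq> span X"
proof -
  obtain C where C: "C \<subseteq> X" "independent C" "X \<subseteq> span C" "card C = dim X"
    using basis_exists by blast
  have "C \<subseteq> V" using C(1) assms(3) by blast
  then obtain B where B: "C \<subseteq> B" "V \<subseteq> span B" "finite B" "card B = dim V"
    using finite_basis_extend[OF assms(1,2) _ C(2)] by blast
  have "C = B" using card_seteq[OF B(3,1)] B(4) C(4) assms(4) by simp
  then show ?thesis using B(2) span_mono[OF C(1)] by blast
qed

text \<open>A basis of \<open>Z\<close> extends to bases of \<open>X\<close> and of
  \<open>Y\<close>; their union spans \<open>X \<union> Y\<close> and their intersection still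
  contains the basis of \<open>Z\<close>. The set \<open>Z\<close> may be smaller than
  \<open>X \<inter> Y\<close>, because the values of the columns in \<open>J \<inter> K\<close> need
  not exhaust the values common to the columns in \<open>J\<close> and in \<open>K\<close>.\<close>

lemma dim_submodular:
  assumes "finite E" "X \<subseteq> span E" "Y \<subseteq> span E" "Z \<subseteq> X" "Z \<subseteq> Y"
  shows "dim (X \<union> Y) + dim Z \<le> dim X + dim Y"
proof -
  obtain C where C: "C \<subseteq> Z" "independent C" "Z \<subseteq> span C" "card C = dim Z"
    by (rule basis_exists)
  obtain B where B: "C \<subseteq> B" "X \<subseteq> span B" "finite B" "card B = dim X"
    using finite_basis_extend[OF assms(1,2) subset_trans[OF C(1) assms(4)] C(2)] by blast
  obtain D where D: "C \<subseteq> D" "Y \<subseteq> span D" "finite D" "card D = dim Y"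
    using finite_basis_extend[OF assms(1,3) subset_trans[OF C(1) assms(5)] C(2)] by blast
  have "X \<union> Y \<subseteq> span (B \<union> D)"
    using subset_trans[OF B(2) span_mono[OF Un_upper1]] subset_trans[OF D(2) span_mono[OF Un_upper2]]
    by (rule Un_least)
  then have "dim (X \<union> Y) \<le> card (B \<union> D)" by (rule dim_le_card) (simp add: B(3) D(3))
  moreover have "card (B \<union> D) + card (B \<inter> D) = card B + card D"
    using card_Un_Int[OF B(3) D(3)] by simp
  moreover have "card C \<le> card (B \<inter> D)" using B(1,3) D(1) by (intro card_mono) auto
  ultimately show ?thesis using B(4) D(4) C(4) by linarith
qed

text \<open>Rank counts columns by index, so a repeated column has to be a dependency; independence
  of the image set alone would overlook it.\<close>

definition family_independent :: "('i \<Rightarrow> 'b) \<Rightarrow> 'i set \<Rightarrow> bool" where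
  "family_independent x I \<longleftrightarrow> inj_on x I \<and> independent (x ` I)"

lemma family_independent_iff:
  assumes "finite I"
  shows "family_independent x I \<longleftrightarrow>
    (\<forall>u. (\<Sum>j\<in>I. u j *s x j) = 0 \<longrightarrow> (\<forall>j\<in>I. u j = 0))" (is "?L \<longleftrightarrow> ?R")
proof
  assume L: ?L
  then have inj: "inj_on x I" and ind: "independent (x ` I)" by (auto simp: family_independent_def)
  show ?R
  proof (intro allI impI ballI)
    fix u j assume s: "(\<Sum>j\<in>I. u j *s x j) = 0" and j: "j \<in> I"
    define w where "w = (\<lambda>y. u (inv_into I x y))"
    have "(\<Sum>y\<in>x ` I. w y *s y) = (\<Sum>j\<in>I. u j *s x j)"
      unfolding sum.reindex[OF inj] by (rule sum.cong) (auto simp: w_def inj inv_into_f_f)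
    then have "w (x j) = 0"
      using ind[unfolded independent_explicit_finite_subsets, rule_format, OF order_refl, of w "x j"]
        s j assms by simp
    then show "u j = 0" by (simp add: w_def inj j inv_into_f_f)
  qed
next
  assume R: ?R
  have inj: "inj_on x I"
  proof (rule inj_onI, rule ccontr)
    fix i j assume ij: "i \<in> I" "j \<in> I" "x i = x j" "i \<noteq> j"
    define u where "u = (\<lambda>l. if l = i then 1 else if l = j then -1 else 0 :: 'a)"
    have "(\<Sum>l\<in>I. u l *s x l) = (\<Sum>l\<in>{i,j}. u l *s x l)"
      using ij assms by (intro sum.mono_neutral_right) (auto simp: u_def)
    also have "\<dots> = 0" using ij by (simp add: u_def)
    finally have "u i = 0" using R ij by blast
    then show False by (simp add: u_def)
  qed
  have "independent (x ` I)"
  proof (rule independent_if_scalars_zero)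
    fix w y assume s: "(\<Sum>y\<in>x ` I. w y *s y) = 0" and y: "y \<in> x ` I"
    have "(\<Sum>j\<in>I. w (x j) *s x j) = 0" using s unfolding sum.reindex[OF inj] by simp
    then show "w y = 0" using R[rule_format, of "w \<circ> x"] y by auto
  qed (use assms in simp)
  then show ?L using inj by (simp add: family_independent_def)
qed

lemma family_independent_mono:
  "family_independent x I \<Longrightarrow> K \<subseteq> I \<Longrightarrow> family_independent x K"
  unfolding family_independent_def
  using independent_mono[of "x ` I" "x ` K"] inj_on_subset[of x I K] by blast

lemma family_independent_card_le_dim:
  assumes "finite E" "V \<subseteq> span E" "x ` I \<subseteq> V" "family_independent x I"
  shows "card I \<le> dim V"
proof -
  have "card I = card (x ` I)" using assms(4) by (simp add: family_independent_def card_image)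
  then show ?thesis using card_le_dim[OF assms(1-3)] assms(4) by (simp add: family_independent_def)
qed

lemma family_independent_spans:
  assumes "finite E" "V \<subseteq> span E" "x ` I \<subseteq> V" "family_independent x I" "dim V \<le> card I"
  shows "V \<subseteq> span (x ` I)"
proof (rule subset_span_if_dim_le[OF assms(1-3)])
  have "dim (x ` I) = card (x ` I)"
    using assms(4) dim_eq_card_independent by (simp add: family_independent_def)
  then show "dim V \<le> dim (x ` I)"
    using assms(4,5) by (simp add: family_independent_def card_image)
qed

lemma ex_family_independent:
  assumes "finite J"
  obtains I where "I \<subseteq> J" "family_independent x I" "card I = dim (x ` J)"
proof -
  obtain B where B: "B \<subseteq> x ` J" "independent B" "x ` J \<subseteq> span B" "card B = dim (x ` J)"
    by (rule basis_exists)
  obtain I where I: "I \<subseteq> J" "B = x ` I" "inj_on x I"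
    using B(1) unfolding subset_image_inj by blast
  then show thesis using that[of I] B by (simp add: family_independent_def card_image)
qed

text \<open>If every choice \<open>y \<in> A j\<close> violated the rank condition, the violating index sets would all be
  tight; tight sets are closed under union by submodularity, so one tight set would span \<open>A j\<close>.\<close>

lemma rado_step:
  assumes "finite J" "finite E" and sub: "\<And>i. i \<in> J \<Longrightarrow> A i \<subseteq> span E"
    and cond: "\<And>K. K \<subseteq> J \<Longrightarrow> card K \<le> dim (\<Union>i\<in>K. A i) + d"
    and j: "j \<in> J" "A j \<noteq> {}"
  shows "\<exists>y\<in>A j. \<forall>K\<subseteq>J. card K \<le> dim (\<Union>i\<in>K. (A(j := {y})) i) + d"
proof (rule ccontr)
  assume neg: "\<not> ?thesis"
  define f where "f K = dim (\<Union>i\<in>K. A i)" for K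
  define tight where "tight K \<longleftrightarrow> K \<subseteq> J - {j} \<and> f K + d = card K" for K
  have subE: "(\<Union>i\<in>K. A i) \<subseteq> span E" if "K \<subseteq> J" for K using sub that by blast
  have viol: "\<exists>K. tight K \<and> y \<in> span (\<Union>i\<in>K. A i)" if y: "y \<in> A j" for y
  proof -
    obtain L where L: "L \<subseteq> J" "dim (\<Union>i\<in>L. (A(j := {y})) i) + d < card L"
      using neg y unfolding not_le[symmetric] by blast
    have jL: "j \<in> L"
    proof (rule ccontr)
      assume "j \<notin> L"
      then have "(\<Union>i\<in>L. (A(j := {y})) i) = (\<Union>i\<in>L. A i)" by auto
      then show False using L cond[OF L(1)] by simp
    qed
    define K where "K = L - {j}"
    have K: "K \<subseteq> J - {j}" "card L = Suc (card K)"
      using L jL card_Suc_Diff1[OF finite_subset[OF L(1) assms(1)] jL] by (auto simp: K_def)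
    have eq: "(\<Union>i\<in>L. (A(j := {y})) i) = insert y (\<Union>i\<in>K. A i)"
      using jL by (auto simp: K_def)
    have iE: "insert y (\<Union>i\<in>K. A i) \<subseteq> span E"
      using subsetD[OF sub[OF j(1)] y] subE[OF subset_trans[OF K(1) Diff_subset]] by simp
    \<comment> \<open>Squeeze: \<open>card K \<le> f K + d \<le> dim (insert y ...) + d < card L =
      card K + 1\<close>. The weak inequalities are therefore equalities, so \<open>K\<close> is
      tight and \<open>y\<close> adds no dimension to it.\<close>
    have le: "dim (\<Union>i\<in>K. A i) \<le> dim (insert y (\<Union>i\<in>K. A i))"
      by (rule dim_mono_finite[OF assms(2) iE subset_trans[OF subset_insertI span_superset]])
    have c: "card K \<le> f K + d" unfolding f_def by (rule cond[OF subset_trans[OF K(1) Diff_subset]])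
    note L2 = L(2)[unfolded eq]
    have "tight K" using le c K L2 unfolding tight_def f_def by linarith
    moreover have "insert y (\<Union>i\<in>K. A i) \<subseteq> span (\<Union>i\<in>K. A i)"
      using subset_span_if_dim_le[OF assms(2) iE subset_insertI] c K L2 by (simp add: f_def)
    ultimately show ?thesis by (intro exI[of _ K] conjI) simp_all
  qed
  have tight_Un: "tight (K \<union> L)" if "tight K" "tight L" for K L
  proof -
    have KL: "K \<subseteq> J - {j}" "L \<subseteq> J - {j}" "f K + d = card K" "f L + d = card L"
      using that by (auto simp: tight_def)
    have fin: "finite K" "finite L" using finite_subset[OF KL(1)] finite_subset[OF KL(2)] assms(1) by auto
    have "dim ((\<Union>i\<in>K. A i) \<union> (\<Union>i\<in>L. A i)) + dim (\<Union>i\<in>K \<inter> L. A i) \<le> f K + f L"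
      unfolding f_def using KL by (intro dim_submodular[OF assms(2)] subE) auto
    moreover have "(\<Union>i\<in>K\<union>L. A i) = (\<Union>i\<in>K. A i) \<union> (\<Union>i\<in>L. A i)" by blast
    ultimately have "f (K \<union> L) + f (K \<inter> L) \<le> f K + f L" by (simp only: f_def)
    moreover have "card (K \<inter> L) \<le> f (K \<inter> L) + d" "card (K \<union> L) \<le> f (K \<union> L) + d"
      using KL unfolding f_def by (intro cond; blast)+
    ultimately show ?thesis using KL card_Un_Int[OF fin] by (auto simp: tight_def)
  qed
  \<comment> \<open>The empty union \<open>{}\<close> is tight only for \<open>d = 0\<close>, so at
    least one tight set is required; it comes from \<open>A j\<close> being nonempty.\<close>
  obtain y0 K0 where K0: "y0 \<in> A j" "tight K0" using j viol by blast
  define T where "T = {K. tight K}"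
  have "T \<subseteq> Pow (J - {j})" by (auto simp: T_def tight_def)
  then have T: "finite T" "T \<noteq> {}"
    using finite_subset[of T "Pow (J - {j})"] assms(1) K0(2) unfolding T_def by auto
  have "tight (\<Union>T')" if "finite T'" "T' \<noteq> {}" "T' \<subseteq> T" for T'
    using that by (induction T' rule: finite_ne_induct) (auto simp: T_def intro: tight_Un)
  then have U: "tight (\<Union>T)" using T by blast
  have subU: "A j \<subseteq> span (\<Union>i\<in>\<Union>T. A i)"
  proof
    fix y assume "y \<in> A j"
    then obtain K where K: "tight K" "y \<in> span (\<Union>i\<in>K. A i)" using viol by blast
    have "(\<Union>i\<in>K. A i) \<subseteq> (\<Union>i\<in>\<Union>T. A i)" using K by (auto simp: T_def)
    from span_mono[OF this] K(2) show "y \<in> span (\<Union>i\<in>\<Union>T. A i)" by (rule subsetD)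
  qed
  have UJ: "\<Union>T \<subseteq> J - {j}" "f (\<Union>T) + d = card (\<Union>T)" using U by (auto simp: tight_def)
  \<comment> \<open>Adding \<open>j\<close> to the tight set \<open>\<Union>T\<close> raises the
    cardinality by one and the dimension by nothing, against \<open>cond\<close>.\<close>
  have "(\<Union>i\<in>insert j (\<Union>T). A i) \<subseteq> span (\<Union>i\<in>\<Union>T. A i)"
    unfolding UN_insert using subU span_superset by (rule Un_least)
  then have "f (insert j (\<Union>T)) \<le> f (\<Union>T)" unfolding f_def
    by (rule dim_mono_finite[OF assms(2) subE[OF subset_trans[OF UJ(1) Diff_subset]]])
  moreover have "card (insert j (\<Union>T)) \<le> f (insert j (\<Union>T)) + d"
    unfolding f_def using UJ j by (intro cond) auto
  moreover have "card (insert j (\<Union>T)) = Suc (card (\<Union>T))"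
    using UJ(1) finite_subset[OF UJ(1) finite_Diff[OF assms(1)]] by (intro card_insert_disjoint) auto
  ultimately show False using UJ by simp
qed

text \<open>\<open>rado_step\<close> preserves the rank condition while one set is shrunk to a
  single vector, so all sets can be shrunk in turn. The condition for \<open>K = J\<close> then
  bounds the rank of the chosen family from below.\<close>

theorem rado_defect:
  assumes "finite J" "finite E" and sub: "\<And>i. i \<in> J \<Longrightarrow> A i \<subseteq> span E"
    and cond: "\<And>K. K \<subseteq> J \<Longrightarrow> card K \<le> dim (\<Union>i\<in>K. A i) + d"
    and ne: "\<And>i. i \<in> J \<Longrightarrow> A i \<noteq> {}"
  shows "\<exists>x. (\<forall>i\<in>J. x i \<in> A i) \<and> (\<exists>I\<subseteq>J. family_independent x I \<and> card J \<le> card I + d)"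
proof -
  have "\<exists>x. (\<forall>i\<in>L. x i \<in> A i) \<and>
      (\<forall>K\<subseteq>J. card K \<le> dim (\<Union>i\<in>K. if i \<in> L then {x i} else A i) + d)" if "L \<subseteq> J" for L
    using finite_subset[OF that assms(1)] that
  proof (induction L rule: finite_induct)
    case empty
    then show ?case using cond by simp
  next
    case (insert j L)
    then obtain x where x: "\<forall>i\<in>L. x i \<in> A i"
      "\<forall>K\<subseteq>J. card K \<le> dim (\<Union>i\<in>K. if i \<in> L then {x i} else A i) + d" by auto
    let ?B = "\<lambda>i. if i \<in> L then {x i} else A i"
    have "?B i \<subseteq> span E" if "i \<in> J" for i using sub[OF that] x(1) by auto
    then have "\<exists>y\<in>?B j. \<forall>K\<subseteq>J. card K \<le> dim (\<Union>i\<in>K. (?B(j := {y})) i) + d"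
      using insert x ne by (intro rado_step[OF assms(1,2)]) auto
    then obtain y where y: "y \<in> A j" "\<forall>K\<subseteq>J. card K \<le> dim (\<Union>i\<in>K. (?B(j := {y})) i) + d"
      using insert(2) by auto
    have "(?B(j := {y})) = (\<lambda>i. if i \<in> insert j L then {(x(j := y)) i} else A i)"
      using insert(2) by (auto simp: fun_eq_iff)
    then show ?case using x(1) y insert(2) by (intro exI[of _ "x(j := y)"]) auto
  qed
  from this[OF order_refl] obtain x where x: "\<forall>i\<in>J. x i \<in> A i"
    "\<forall>K\<subseteq>J. card K \<le> dim (\<Union>i\<in>K. if i \<in> J then {x i} else A i) + d" by blast
  have "(\<Union>i\<in>J. if i \<in> J then {x i} else A i) = x ` J" by auto
  then have "card J \<le> dim (x ` J) + d" using x(2)[rule_format, OF order_refl] by simp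
  moreover obtain I where "I \<subseteq> J" "family_independent x I" "card I = dim (x ` J)"
    by (rule ex_family_independent[OF assms(1)])
  ultimately show ?thesis using x(1) by (intro exI[of _ x]) (auto intro!: exI[of _ I])
qed

end

section \<open>Column vectors and matrix rank\<close>

text \<open>Vectors are functions on \<open>nat\<close>; those of length \<open>r\<close> are the functions in \<open>low r\<close>, which makes the
  coordinate subspaces literally nested.\<close>

definition fscale :: "'a::field \<Rightarrow> (nat \<Rightarrow> 'a) \<Rightarrow> nat \<Rightarrow> 'a" where
  "fscale c x = (\<lambda>i. c * x i)"

interpretation fs: linear_families fscale
  by unfold_locales (auto simp: fscale_def fun_eq_iff algebra_simps)

lemma sum_fun_apply: "(\<Sum>j\<in>I. g j) i = (\<Sum>j\<in>I. g j i)"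
  by (induction I rule: infinite_finite_induct) auto

definition low :: "nat \<Rightarrow> (nat \<Rightarrow> 'a::field) set" where
  "low r = {x. \<forall>i\<ge>r. x i = 0}"

definition unitf :: "nat \<Rightarrow> nat \<Rightarrow> 'a::field" where
  "unitf i = (\<lambda>l. if l = i then 1 else 0)"

lemma sum_unitf:
  "finite I \<Longrightarrow> (\<Sum>j\<in>I. fscale (u j) (unitf j)) i = (if i \<in> I then u i else 0)"
  by (simp add: sum_fun_apply fscale_def unitf_def if_distrib[of "\<lambda>x. _ * x"] sum.delta' cong: if_cong)

lemma family_independent_unitf: "finite I \<Longrightarrow> fs.family_independent unitf I"
  unfolding fs.family_independent_iff
  by (metis sum_unitf zero_fun_apply)

lemma subspace_low: "fs.subspace (low r)"
  by (auto simp: fs.subspace_def low_def fscale_def)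

lemma low_mono: "r \<le> s \<Longrightarrow> low r \<subseteq> low s"
  by (auto simp: low_def)

lemma span_unitf: "fs.span (unitf ` {..<r}) = (low r :: (nat \<Rightarrow> 'a::field) set)" (is "?L = ?R")
proof (rule antisym)
  show "?L \<subseteq> ?R"
    by (rule fs.span_minimal[OF _ subspace_low]) (auto simp: low_def unitf_def)
  show "?R \<subseteq> ?L"
  proof
    fix x :: "nat \<Rightarrow> 'a" assume x: "x \<in> low r"
    have "x = (\<Sum>j<r. fscale (x j) (unitf j))"
    proof
      fix i show "x i = (\<Sum>j<r. fscale (x j) (unitf j)) i"
        unfolding sum_unitf[OF finite_lessThan] using x by (auto simp: low_def)
    qed
    also have "\<dots> \<in> fs.span (unitf ` {..<r})"
      by (intro fs.span_sum fs.span_scale fs.span_base) auto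
    finally show "x \<in> fs.span (unitf ` {..<r})" .
  qed
qed

lemma dim_low: "fs.dim (low r) = r"
proof -
  have "fs.family_independent unitf {..<r}" by (rule family_independent_unitf) simp
  then have "inj_on (unitf :: nat \<Rightarrow> nat \<Rightarrow> 'a) {..<r}" "fs.independent (unitf ` {..<r} :: (nat \<Rightarrow> 'a) set)"
    by (auto simp: fs.family_independent_def)
  then show ?thesis unfolding span_unitf[symmetric]
    by (simp add: fs.dim_eq_card_independent card_image)
qed

lemma finite_unitf: "finite (unitf ` {..<r})" by simp

lemmas low_subset_span = equalityD2[OF span_unitf]

definition colf :: "'a::field mat \<Rightarrow> nat \<Rightarrow> nat \<Rightarrow> 'a" where
  "colf A j = (\<lambda>i. if i < dim_row A then A $$ (i, j) else 0)"

lemma colf_low: "colf A j \<in> low (dim_row A)"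
  by (simp add: colf_def low_def)

lemma colf_family_independent_iff:
  assumes "finite I"
  shows "fs.family_independent (colf A) I \<longleftrightarrow>
    (\<forall>u. (\<forall>i<dim_row A. (\<Sum>j\<in>I. u j * A $$ (i, j)) = 0) \<longrightarrow> (\<forall>j\<in>I. u j = 0))"
proof -
  have "(\<Sum>j\<in>I. fscale (u j) (colf A j)) = 0 \<longleftrightarrow>
      (\<forall>i<dim_row A. (\<Sum>j\<in>I. u j * A $$ (i, j)) = 0)" for u
  proof -
    have "(\<Sum>j\<in>I. fscale (u j) (colf A j)) i = (if i < dim_row A then \<Sum>j\<in>I. u j * A $$ (i, j) else 0)" for i
      by (simp add: sum_fun_apply fscale_def colf_def)
    then show ?thesis by (simp add: fun_eq_iff)
  qed
  then show ?thesis unfolding fs.family_independent_iff[OF assms] by simp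
qed

definition vecf :: "'a::field vec \<Rightarrow> nat \<Rightarrow> 'a" where
  "vecf v = (\<lambda>i. if i < dim_vec v then v $ i else 0)"

lemma inj_on_vecf: "inj_on vecf (carrier_vec n)"
proof (rule inj_onI)
  fix v w :: "'a vec" assume v: "v \<in> carrier_vec n" and w: "w \<in> carrier_vec n" and eq: "vecf v = vecf w"
  show "v = w"
  proof (rule eq_vecI)
    fix i assume "i < dim_vec w"
    then show "v $ i = w $ i" using fun_cong[OF eq, of i] v w by (simp add: vecf_def)
  qed (use v w in simp)
qed

lemma vecf_col: "j < dim_col A \<Longrightarrow> vecf (col A j) = colf A j"
  by (auto simp: vecf_def colf_def fun_eq_iff)

context vec_space
begin

text \<open>Rank is defined through \<open>lin_indpt\<close> on vectors of fixed length; padding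
  with zeros by \<open>vecf\<close> carries linear relations over in both directions, since every
  term vanishes from row \<open>n\<close> on.\<close>

lemma lin_indpt_iff_family_independent:
  assumes "finite U" "U \<subseteq> carrier_vec n"
  shows "lin_indpt U \<longleftrightarrow> fs.family_independent vecf U"
proof -
  have eq: "lincomb a U = 0\<^sub>v n \<longleftrightarrow> (\<Sum>y\<in>U. fscale (a y) (vecf y)) = 0" for a
  proof -
    have "lincomb a U = 0\<^sub>v n \<longleftrightarrow> (\<forall>i<n. lincomb a U $ i = 0)"
      using lincomb_dim[OF assms] by (auto simp: vec_eq_iff)
    also have "\<dots> \<longleftrightarrow> (\<forall>i<n. (\<Sum>y\<in>U. a y * y $ i) = 0)"
      using lincomb_index[OF _ assms(2)] by auto
    also have "\<dots> \<longleftrightarrow> (\<forall>i. (\<Sum>y\<in>U. fscale (a y) (vecf y)) i = 0)"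
    proof -
      have "(\<Sum>y\<in>U. fscale (a y) (vecf y)) i = (if i < n then (\<Sum>y\<in>U. a y * y $ i) else 0)" for i
        unfolding sum_fun_apply using assms(2)
        by (auto simp: fscale_def vecf_def intro!: sum.cong sum.neutral)
      then show ?thesis by simp
    qed
    finally show ?thesis by (simp add: fun_eq_iff)
  qed
  show ?thesis
  proof
    assume l: "lin_indpt U"
    show "fs.family_independent vecf U"
      unfolding fs.family_independent_iff[OF assms(1)] eq[symmetric]
    proof (intro allI impI ballI)
      fix u v assume "lincomb u U = 0\<^sub>v n" "v \<in> U"
      then show "u v = 0" using not_lindepD[OF l assms(1) order_refl, of u] by auto
    qed
  next
    assume f: "fs.family_independent vecf U"
    have "\<forall>v\<in>U. a v = 0" if "lincomb a U = 0\<^sub>v n" for a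
      using that f eq unfolding fs.family_independent_iff[OF assms(1)] by blast
    then show "lin_indpt U" by (intro finite_lin_indpt2) (use assms in auto)
  qed
qed

end

section \<open>Rank as the largest number of independent columns\<close>

lemma set_cols_eq: "set (cols A) = col A ` {..<dim_col A}"
  by (auto simp: cols_def)

text \<open>\<open>set (cols A)\<close> forgets repetitions, hence the injectivity of
  \<open>col A\<close> on \<open>I\<close> as a separate conjunct.\<close>

lemma family_independent_col_iff:
  assumes "I \<subseteq> {..<dim_col A}"
  shows "fs.family_independent (colf A) I \<longleftrightarrow>
    inj_on (col A) I \<and> fs.family_independent vecf (col A ` I)"
proof -
  have eq: "colf A j = (vecf \<circ> col A) j" if "j \<in> I" for j using assms vecf_col[of j A] that by auto
  have im: "colf A ` I = vecf ` col A ` I" using eq by (auto simp: image_image)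
  have inj: "inj_on vecf (col A ` I)"
    by (rule inj_on_subset[OF inj_on_vecf[of "dim_row A"]]) auto
  have "inj_on (colf A) I \<longleftrightarrow> inj_on (vecf \<circ> col A) I" using eq by (rule inj_on_cong)
  also have "\<dots> \<longleftrightarrow> inj_on (col A) I" using inj comp_inj_on inj_on_imageI2 by blast
  finally show ?thesis using inj im by (auto simp: fs.family_independent_def)
qed

lemma card_le_mat_rank:
  assumes "I \<subseteq> {..<dim_col A}" "fs.family_independent (colf A) I"
  shows "card I \<le> mat_rank A"
proof -
  interpret vec_space "TYPE('a)" "dim_row A" .
  have sub: "col A ` I \<subseteq> set (cols A)" using assms(1) by (auto simp: set_cols_eq)
  have fin: "finite (col A ` I)" using finite_subset[OF assms(1)] by simp
  have c: "col A ` I \<subseteq> carrier_vec (dim_row A)" by auto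
  have "lin_indpt (col A ` I)" "inj_on (col A) I"
    using assms(2) unfolding family_independent_col_iff[OF assms(1)]
    by (simp_all add: lin_indpt_iff_family_independent[OF fin c])
  then show ?thesis
    using rank_ge_card_indpt[of A "dim_col A", OF _ sub] by (simp add: mat_rank_def card_image)
qed

lemma ex_family_independent_mat_rank:
  obtains I where "I \<subseteq> {..<dim_col A}" "fs.family_independent (colf A) I" "card I = mat_rank A"
proof -
  interpret vec_space "TYPE('a)" "dim_row A" .
  let ?P = "\<lambda>T. T \<subseteq> set (cols A) \<and> lin_indpt T"
  have "?P {}" using lin_dep_def by auto
  then obtain S where S: "maximal S ?P"
    using maximal_exists_superset[of "set (cols A)" ?P "{}"] by blast
  then have PS: "S \<subseteq> col A ` {..<dim_col A}" "lin_indpt S" unfolding maximal_def set_cols_eq by auto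
  from PS(1) obtain I where I: "I \<subseteq> {..<dim_col A}" "inj_on (col A) I" "S = col A ` I"
    unfolding subset_image_inj by blast
  have fin: "finite (col A ` I)" using finite_subset[OF I(1)] by simp
  have c: "col A ` I \<subseteq> carrier_vec (dim_row A)" by auto
  have "fs.family_independent (colf A) I"
    using PS(2) I lin_indpt_iff_family_independent[OF fin c] family_independent_col_iff[OF I(1)] by simp
  moreover have "card I = mat_rank A"
    using rank_card_indpt[OF _ S, of "dim_col A"] I by (simp add: mat_rank_def card_image)
  ultimately show thesis using that I(1) by blast
qed

lemma mat_rank_le: "mat_rank A \<le> min (dim_row A) (dim_col A)"
proof -
  obtain I where I: "I \<subseteq> {..<dim_col A}" "fs.family_independent (colf A) I" "card I = mat_rank A"
    by (rule ex_family_independent_mat_rank)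
  have "card I \<le> fs.dim (low (dim_row A) :: (nat \<Rightarrow> 'a) set)"
    by (rule fs.family_independent_card_le_dim[OF finite_unitf low_subset_span _ I(2)])
      (auto simp: colf_low)
  moreover have "card I \<le> dim_col A" using card_mono[OF _ I(1)] by simp
  ultimately show ?thesis using I(3) by (simp add: dim_low)
qed

lemma completion_dim [simp]:
  "dim_row (completion k M a) = aci_rows M" "dim_col (completion k M a) = aci_cols M"
  by (simp_all add: completion_def)

text \<open>There may be infinitely many completions, but their ranks are bounded by the size of the
  matrix, so \<open>Max\<close> is taken over a finite nonempty set and is attained.\<close>

lemma FmR_iff:
  "FmR k M \<longleftrightarrow> (\<exists>a. \<exists>I \<subseteq> {..<aci_cols M}. card I = min (aci_rows M) (aci_cols M) \<and>
     fs.family_independent (colf (completion k M a)) I)"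
proof -
  let ?S = "{mat_rank (completion k M a) | a. True}"
  have le: "r \<le> min (aci_rows M) (aci_cols M)" if "r \<in> ?S" for r
    using that mat_rank_le completion_dim by (smt (verit) mem_Collect_eq)
  have "?S \<subseteq> {..min (aci_rows M) (aci_cols M)}" using le by blast
  then have fin: "finite ?S" using finite_atMost by (rule finite_subset)
  have ne: "?S \<noteq> {}" by blast
  show ?thesis
  proof
    assume "FmR k M"
    then have "min (aci_rows M) (aci_cols M) \<in> ?S"
      using Max_in[OF fin ne] by (simp only: FmR_def maxRank_def)
    then obtain a where a: "mat_rank (completion k M a) = min (aci_rows M) (aci_cols M)" by auto
    obtain I where "I \<subseteq> {..<dim_col (completion k M a)}"
      "fs.family_independent (colf (completion k M a)) I" "card I = mat_rank (completion k M a)"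
      by (rule ex_family_independent_mat_rank)
    then show "\<exists>a. \<exists>I \<subseteq> {..<aci_cols M}. card I = min (aci_rows M) (aci_cols M) \<and>
     fs.family_independent (colf (completion k M a)) I" using a by auto
  next
    assume "\<exists>a. \<exists>I \<subseteq> {..<aci_cols M}. card I = min (aci_rows M) (aci_cols M) \<and>
     fs.family_independent (colf (completion k M a)) I"
    then obtain a I where I: "I \<subseteq> {..<aci_cols M}" "card I = min (aci_rows M) (aci_cols M)"
      "fs.family_independent (colf (completion k M a)) I" by blast
    have "card I \<le> mat_rank (completion k M a)" using card_le_mat_rank[of I "completion k M a"] I(1,3) by simp
    also have "\<dots> \<le> Max ?S" by (rule Max_ge[OF fin]) auto
    finally have "min (aci_rows M) (aci_cols M) \<le> Max ?S" using I(2) by simp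
    moreover have "Max ?S \<le> min (aci_rows M) (aci_cols M)" using Max_in[OF fin ne] le by blast
    ultimately show "FmR k M" unfolding FmR_def maxRank_def by (rule antisym[rotated])
  qed
qed

section \<open>Completions, transformations and blocks\<close>

text \<open>The matrix-vector product on padded columns. Entries of \<open>x\<close> from
  \<open>dim_col R\<close> on are ignored, so inverse matrices cancel only on \<open>low m\<close>;
  this explains the membership hypotheses below.\<close>

definition act :: "'a::field mat \<Rightarrow> (nat \<Rightarrow> 'a) \<Rightarrow> nat \<Rightarrow> 'a" where
  "act R x = (\<lambda>i. if i < dim_row R then \<Sum>l<dim_col R. R $$ (i, l) * x l else 0)"

lemma act_add: "act R (x + y) = act R x + act R y"
  by (auto simp: act_def fun_eq_iff algebra_simps sum.distrib)

lemma act_fscale: "act R (fscale c x) = fscale c (act R x)"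
  by (auto simp: act_def fscale_def fun_eq_iff algebra_simps sum_distrib_left)

lemma act_0: "act R 0 = 0"
  by (auto simp: act_def fun_eq_iff)

lemma act_sum: "act R (\<Sum>j\<in>I. g j) = (\<Sum>j\<in>I. act R (g j))"
  by (induction I rule: infinite_finite_induct)
    (simp_all only: sum.infinite sum.empty sum.insert act_0 act_add not_False_eq_True)

lemma act_low: "R \<in> carrier_mat m m \<Longrightarrow> act R x \<in> low m"
  by (auto simp: act_def low_def)

lemma act_mult:
  assumes "R \<in> carrier_mat m m" "S \<in> carrier_mat m m"
  shows "act R (act S x) = act (R * S) x"
proof
  fix i
  show "act R (act S x) i = act (R * S) x i"
  proof (cases "i < m")
    case True
    have "act R (act S x) i = (\<Sum>l<m. \<Sum>h<m. R $$ (i, l) * S $$ (l, h) * x h)"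
      using assms True by (simp add: act_def sum_distrib_left mult.assoc)
    also have "\<dots> = (\<Sum>h<m. \<Sum>l<m. R $$ (i, l) * S $$ (l, h) * x h)"
      by (rule sum.swap)
    also have "\<dots> = act (R * S) x i"
      using assms True by (simp add: act_def scalar_prod_def sum_distrib_right atLeast0LessThan)
    finally show ?thesis .
  qed (use assms in \<open>auto simp: act_def\<close>)
qed

lemma act_one: "x \<in> low m \<Longrightarrow> act (1\<^sub>m m) x = x"
  by (auto simp: act_def low_def fun_eq_iff if_distrib[of "\<lambda>c. c * _"] cong: if_cong)

lemma act_inverse:
  assumes "R \<in> carrier_mat m m" "S \<in> carrier_mat m m" "S * R = 1\<^sub>m m" "x \<in> low m"
  shows "act S (act R x) = x"
  using act_mult[OF assms(2,1)] act_one[OF assms(4)] assms(3) by simp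

lemma act_span_subset:
  assumes "\<And>x. x \<in> X \<Longrightarrow> act R x \<in> V" "fs.subspace V" "x \<in> fs.span X"
  shows "act R x \<in> V"
  using assms(3)
proof (induction rule: fs.span_induct_alt)
  case base
  then show ?case unfolding act_0 using assms(2) by (rule fs.subspace_0)
next
  case (step c x y)
  then show ?case unfolding act_add act_fscale
    using assms(1,2) by (intro fs.subspace_add fs.subspace_scale)
qed

text \<open>A left inverse makes \<open>act R\<close> injective on \<open>low m\<close>, so it
  neither creates nor destroys linear relations.\<close>

lemma family_independent_act:
  assumes "R \<in> carrier_mat m m" "S \<in> carrier_mat m m" "S * R = 1\<^sub>m m" "finite I"
    and low: "\<And>j. j \<in> I \<Longrightarrow> x j \<in> low m"
  shows "fs.family_independent (\<lambda>j. act R (x j)) I \<longleftrightarrow> fs.family_independent x I"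
proof -
  have "(\<Sum>j\<in>I. fscale (u j) (act R (x j))) = 0 \<longleftrightarrow> (\<Sum>j\<in>I. fscale (u j) (x j)) = 0" for u
  proof -
    define y where "y = (\<Sum>j\<in>I. fscale (u j) (x j))"
    have "y \<in> low m" unfolding y_def
      by (intro fs.subspace_sum fs.subspace_scale subspace_low low)
    then have y: "act S (act R y) = y" by (rule act_inverse[OF assms(1-3)])
    have "act R y = 0 \<longleftrightarrow> y = 0"
    proof
      assume "act R y = 0"
      then show "y = 0" using y unfolding act_0 by (simp only: act_0)
    qed (simp only: act_0)
    moreover have "(\<Sum>j\<in>I. fscale (u j) (act R (x j))) = act R y"
      by (simp only: y_def act_sum act_fscale)
    ultimately show ?thesis by (simp only: y_def)
  qed
  then show ?thesis unfolding fs.family_independent_iff[OF assms(4)] by simp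
qed

lemma invertible_matE:
  assumes "invertible_mat R" "R \<in> carrier_mat m m"
  obtains S where "S \<in> carrier_mat m m" "R * S = 1\<^sub>m m" "S * R = 1\<^sub>m m"
proof -
  obtain S where S: "R * S = 1\<^sub>m m" "S * R = 1\<^sub>m (dim_row S)"
    using assms unfolding invertible_mat_def inverts_mat_def by auto
  have "dim_col S = m" using arg_cong[OF S(1), of dim_col] by simp
  moreover have "dim_row S = m" using arg_cong[OF S(2), of dim_col] assms(2) by simp
  ultimately show thesis using that[of S] S by auto
qed

lemma invertible_matI:
  assumes "R \<in> carrier_mat m m" "S \<in> carrier_mat m m" "R * S = 1\<^sub>m m" "S * R = 1\<^sub>m m"
  shows "invertible_mat R"
  using assms unfolding invertible_mat_def inverts_mat_def by auto

abbreviation compcol :: "nat \<Rightarrow> 'a::field aci \<Rightarrow> (nat \<Rightarrow> 'a) \<Rightarrow> nat \<Rightarrow> nat \<Rightarrow> 'a" where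
  "compcol k M a \<equiv> colf (completion k M a)"

lemma compcol_eq:
  "j < aci_cols M \<Longrightarrow> compcol k M a j = (\<lambda>i. if i < aci_rows M
     then fst M $$ (i, j) + (\<Sum>v<k. a v * snd M v $$ (i, j)) else 0)"
  by (auto simp: colf_def completion_def)

lemma compcol_low: "compcol k M a j \<in> low (aci_rows M)"
  using colf_low[of "completion k M a" j] by simp

lemma mult_perm_mat:
  assumes "A \<in> carrier_mat m n" "p permutes {..<n}" "i < m" "j < n"
  shows "(A * perm_mat n p) $$ (i, j) = A $$ (i, p j)"
proof -
  have "p j < n" using permutes_in_image[OF assms(2)] assms(4) by simp
  then show ?thesis using assms
    by (simp add: perm_mat_def scalar_prod_def if_distrib[of "\<lambda>c. _ * c"] cong: if_cong)
qed

lemma aci_mult_dims [simp]: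
  "R \<in> carrier_mat m m \<Longrightarrow> aci_rows (aci_mult R M Q) = m"
  "aci_cols (aci_mult R M (perm_mat n p)) = n"
  by (auto simp: aci_rows_def aci_cols_def aci_mult_def perm_mat_def)

lemma compcol_aci_mult:
  assumes "\<forall>v<k. snd M v \<in> carrier_mat (aci_rows M) (aci_cols M)"
    "R \<in> carrier_mat (aci_rows M) (aci_rows M)" "p permutes {..<aci_cols M}" "j < aci_cols M"
  shows "compcol k (aci_mult R M (perm_mat (aci_cols M) p)) a j = act R (compcol k M a (p j))"
proof
  fix i
  let ?m = "aci_rows M" and ?n = "aci_cols M"
  have pj: "p j < ?n" using permutes_in_image[OF assms(3)] assms(4) by simp
  have ent: "(R * A * perm_mat ?n p) $$ (i, j) = (\<Sum>l<?m. R $$ (i, l) * A $$ (l, p j))"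
    if A: "A \<in> carrier_mat ?m ?n" and i: "i < ?m" for A
    using mult_perm_mat[OF mult_carrier_mat[OF assms(2) A] assms(3) i assms(4)] A i assms(2) pj
    by (simp add: scalar_prod_def atLeast0LessThan)
  have C: "fst M \<in> carrier_mat ?m ?n" by (auto simp: aci_rows_def aci_cols_def)
  have V: "snd M v \<in> carrier_mat ?m ?n" if "v < k" for v using assms(1) that by simp
  show "compcol k (aci_mult R M (perm_mat ?n p)) a j i = act R (compcol k M a (p j)) i"
  proof (cases "i < ?m")
    case True
    have "compcol k (aci_mult R M (perm_mat ?n p)) a j i =
        (\<Sum>l<?m. R $$ (i, l) * fst M $$ (l, p j)) +
        (\<Sum>v<k. a v * (\<Sum>l<?m. R $$ (i, l) * snd M v $$ (l, p j)))"
      using True assms(2,4) ent[OF C True] ent[OF V True]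
      by (simp add: compcol_eq) (simp add: aci_mult_def)
    also have "(\<Sum>v<k. a v * (\<Sum>l<?m. R $$ (i, l) * snd M v $$ (l, p j))) =
        (\<Sum>l<?m. \<Sum>v<k. R $$ (i, l) * (a v * snd M v $$ (l, p j)))"
      by (subst sum.swap) (simp add: sum_distrib_left mult.left_commute)
    finally show ?thesis
      using True assms(2) pj by (simp add: act_def compcol_eq sum_distrib_left distrib_left sum.distrib)
  qed (use assms(2) in \<open>auto simp: act_def colf_def\<close>)
qed

text \<open>No indeterminate occurs in two columns, so the columns can be completed independently.\<close>

lemma ex_compcol_eq:
  assumes "is_aci k M"
  shows "\<exists>a. \<forall>j<aci_cols M. compcol k M a j = compcol k M (b j) j"
proof -
  have "\<forall>v. \<exists>j. v < k \<longrightarrow> (\<forall>i l. i < aci_rows M \<longrightarrow> l < aci_cols M \<longrightarrow> snd M v $$ (i, l) \<noteq> 0 \<longrightarrow> l = j)"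
    using assms by (auto simp: is_aci_def)
  \<comment> \<open>\<open>h v\<close> is the only column in which \<open>v\<close> can occur, so
    \<open>v\<close> gets its value from the completion chosen for that column.\<close>
  then obtain h where h: "\<And>v i l. v < k \<Longrightarrow> i < aci_rows M \<Longrightarrow> l < aci_cols M \<Longrightarrow>
      snd M v $$ (i, l) \<noteq> 0 \<Longrightarrow> l = h v" by metis
  have "a1 = a2" if "a1 = b (h v) v * snd M v $$ (i, j)" "a2 = b j v * snd M v $$ (i, j)"
    "v < k" "i < aci_rows M" "j < aci_cols M" for a1 a2 v i j
    using h[of v i j] that by (cases "snd M v $$ (i, j) = 0") auto
  then have "\<forall>j<aci_cols M. compcol k M (\<lambda>v. b (h v) v) j = compcol k M (b j) j"
    by (auto simp: compcol_eq fun_eq_iff intro!: sum.cong)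
  then show ?thesis by blast
qed

text \<open>The zero assignment and the unit assignments recover all coefficients of an affine form
  over any field. Equality of entries, and vanishing of blocks, can therefore be tested on
  completions.\<close>

lemma affine_eq_iff:
  fixes c d :: "'a::field" and b e :: "nat \<Rightarrow> 'a"
  shows "(\<forall>a. c + (\<Sum>v<k. a v * b v) = d + (\<Sum>v<k. a v * e v)) \<longleftrightarrow> c = d \<and> (\<forall>v<k. b v = e v)"
proof
  assume H: "\<forall>a. c + (\<Sum>v<k. a v * b v) = d + (\<Sum>v<k. a v * e v)"
  have cd: "c = d" using H[rule_format, of "\<lambda>_. 0"] by simp
  have "b v = e v" if "v < k" for v
  proof -
    have "(\<Sum>w<k. (if w = v then 1 else 0) * g w) = g v" for g :: "nat \<Rightarrow> 'a"
      using that by (simp add: if_distrib[of "\<lambda>c. c * _"] cong: if_cong)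
    then show ?thesis using H[rule_format, of "\<lambda>w. if w = v then 1 else 0"] cd by simp
  qed
  then show "c = d \<and> (\<forall>v<k. b v = e v)" using cd by blast
qed auto

section \<open>Blocks of a completed matrix\<close>

lemma aci_block_dims [simp]:
  "aci_rows (aci_block N r0 r1 c0 c1) = r1 - r0" "aci_cols (aci_block N r0 r1 c0 c1) = c1 - c0"
  by (auto simp: aci_rows_def aci_cols_def aci_block_def)

lemma compcol_aci_block:
  assumes "r1 \<le> aci_rows N" "c1 \<le> aci_cols N" "i < r1 - r0" "j < c1 - c0"
  shows "compcol k (aci_block N r0 r1 c0 c1) a j i = compcol k N a (j + c0) (i + r0)"
proof -
  have "j + c0 < aci_cols N" "i + r0 < aci_rows N" using assms by auto
  then show ?thesis using assms by (simp add: compcol_eq) (simp add: aci_block_def)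
qed

lemma aci_zero_block_iff:
  assumes "r1 \<le> aci_rows N" "c1 \<le> aci_cols N"
  shows "aci_zero k (aci_block N r0 r1 c0 c1) \<longleftrightarrow>
    (\<forall>a. \<forall>j\<in>{c0..<c1}. \<forall>i\<in>{r0..<r1}. compcol k N a j i = 0)"
proof -
  have "aci_zero k (aci_block N r0 r1 c0 c1) \<longleftrightarrow>
    (\<forall>j<c1-c0. \<forall>i<r1-r0. \<forall>a. compcol k (aci_block N r0 r1 c0 c1) a j i = 0)"
  proof -
    have "(\<forall>a. compcol k (aci_block N r0 r1 c0 c1) a j i = 0) \<longleftrightarrow>
      fst (aci_block N r0 r1 c0 c1) $$ (i, j) = 0 \<and>
      (\<forall>v<k. snd (aci_block N r0 r1 c0 c1) v $$ (i, j) = 0)" if "j < c1 - c0" "i < r1 - r0" for i j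
      using affine_eq_iff[of "fst (aci_block N r0 r1 c0 c1) $$ (i, j)"
          "\<lambda>v. snd (aci_block N r0 r1 c0 c1) v $$ (i, j)" k 0 "\<lambda>_. 0"] that
      by (simp add: compcol_eq)
    then show ?thesis unfolding aci_zero_def by auto
  qed
  also have "\<dots> \<longleftrightarrow> (\<forall>j<c1-c0. \<forall>i<r1-r0. \<forall>a. compcol k N a (j + c0) (i + r0) = 0)"
    using compcol_aci_block[OF assms] by simp
  also have "\<dots> \<longleftrightarrow> (\<forall>a. \<forall>j\<in>{c0..<c1}. \<forall>i\<in>{r0..<r1}. compcol k N a j i = 0)"
  proof (intro iffI allI ballI impI)
    fix a j i assume H: "\<forall>j<c1-c0. \<forall>i<r1-r0. \<forall>a. compcol k N a (j + c0) (i + r0) = 0"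
      and ij: "j \<in> {c0..<c1}" "i \<in> {r0..<r1}"
    have "j - c0 < c1 - c0" "i - r0 < r1 - r0" using ij by auto
    then have "compcol k N a (j - c0 + c0) (i - r0 + r0) = 0" using H by blast
    then show "compcol k N a j i = 0" using ij by simp
  qed auto
  finally show ?thesis .
qed

text \<open>Independence of the columns in \<open>I\<close> when only the rows
  \<open>r0..<r1\<close> are kept. Rows and columns retain their indices in the full matrix, so
  neighbouring blocks can be glued without shifts.\<close>

definition block_indep :: "(nat \<Rightarrow> nat \<Rightarrow> 'a::field) \<Rightarrow> nat \<Rightarrow> nat \<Rightarrow> nat set \<Rightarrow> bool" where
  "block_indep y r0 r1 I \<longleftrightarrow>
     (\<forall>u. (\<forall>i\<in>{r0..<r1}. (\<Sum>j\<in>I. u j * y j i) = 0) \<longrightarrow> (\<forall>j\<in>I. u j = 0))"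

lemma image_shift_lessThan: "(\<lambda>j. j + c) ` {..<d - c} = {c..<d::nat}"
proof (intro equalityI subsetI)
  fix j assume "j \<in> {c..<d}"
  then show "j \<in> (\<lambda>j. j + c) ` {..<d - c}" by (intro image_eqI[of _ _ "j - c"]) auto
qed auto

lemma FmR_block_iff:
  assumes "r1 \<le> aci_rows N" "c1 \<le> aci_cols N"
  shows "FmR k (aci_block N r0 r1 c0 c1) \<longleftrightarrow>
    (\<exists>a. \<exists>I \<subseteq> {c0..<c1}. card I = min (r1 - r0) (c1 - c0) \<and> block_indep (compcol k N a) r0 r1 I)"
proof -
  let ?B = "aci_block N r0 r1 c0 c1" and ?s = "\<lambda>j. j + c0"
  have ind: "fs.family_independent (compcol k ?B a) I \<longleftrightarrow> block_indep (compcol k N a) r0 r1 (?s ` I)"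
    (is "?L \<longleftrightarrow> ?R") if I: "I \<subseteq> {..<c1 - c0}" for a I
  proof -
    have fin: "finite I" using finite_subset[OF I] by simp
    have ent: "completion k ?B a $$ (i, j) = compcol k N a (j + c0) (i + r0)"
      if "i < r1 - r0" "j \<in> I" for i j
      using compcol_aci_block[OF assms that(1), of j c0 k a] that I by (auto simp: colf_def)
    have "?L \<longleftrightarrow> (\<forall>u. (\<forall>i<r1 - r0. (\<Sum>j\<in>I. u j * compcol k N a (j + c0) (i + r0)) = 0) \<longrightarrow> (\<forall>j\<in>I. u j = 0))"
      unfolding colf_family_independent_iff[OF fin] using ent by simp
    also have "\<dots> \<longleftrightarrow> (\<forall>u. (\<forall>i<r1 - r0. (\<Sum>j\<in>?s ` I. u j * compcol k N a j (i + r0)) = 0) \<longrightarrow> (\<forall>j\<in>?s ` I. u j = 0))"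
    proof (intro iffI allI impI)
      fix u :: "nat \<Rightarrow> 'a"
      assume H: "\<forall>u. (\<forall>i<r1 - r0. (\<Sum>j\<in>I. u j * compcol k N a (j + c0) (i + r0)) = 0) \<longrightarrow> (\<forall>j\<in>I. u j = 0)"
        and u: "\<forall>i<r1 - r0. (\<Sum>j\<in>?s ` I. u j * compcol k N a j (i + r0)) = 0"
      have "\<forall>j\<in>I. u (?s j) = 0"
        by (rule H[THEN spec, THEN mp, of "\<lambda>j. u (?s j)"]) (use u in \<open>simp add: sum.reindex\<close>)
      then show "\<forall>j\<in>?s ` I. u j = 0" by simp
    next
      fix u :: "nat \<Rightarrow> 'a"
      assume H: "\<forall>u. (\<forall>i<r1 - r0. (\<Sum>j\<in>?s ` I. u j * compcol k N a j (i + r0)) = 0) \<longrightarrow> (\<forall>j\<in>?s ` I. u j = 0)"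
        and u: "\<forall>i<r1 - r0. (\<Sum>j\<in>I. u j * compcol k N a (j + c0) (i + r0)) = 0"
      have "\<forall>j\<in>?s ` I. u (j - c0) = 0"
        by (rule H[THEN spec, THEN mp, of "\<lambda>j. u (j - c0)"]) (use u in \<open>simp add: sum.reindex\<close>)
      then show "\<forall>j\<in>I. u j = 0" by simp
    qed
    also have "\<dots> \<longleftrightarrow> ?R"
      unfolding block_indep_def image_shift_lessThan[symmetric, of r0 r1] ball_simps(9)
      by (simp only: lessThan_iff Ball_def)
    finally show ?thesis .
  qed
  have sub: "I \<subseteq> {c0..<c1} \<longleftrightarrow> (\<exists>K\<subseteq>{..<c1 - c0}. I = ?s ` K)" for I
    unfolding image_shift_lessThan[symmetric, of c0 c1] by (rule subset_image_iff)
  have "FmR k ?B \<longleftrightarrow> (\<exists>a. \<exists>K \<subseteq> {..<c1 - c0}. card (?s ` K) = min (r1 - r0) (c1 - c0) \<and>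
      block_indep (compcol k N a) r0 r1 (?s ` K))"
    unfolding FmR_iff aci_block_dims
    by (intro arg_cong[where f = Ex] ext conj_cong refl) (simp_all add: ind card_image)
  also have "\<dots> \<longleftrightarrow> (\<exists>a. \<exists>I \<subseteq> {c0..<c1}. card I = min (r1 - r0) (c1 - c0) \<and>
      block_indep (compcol k N a) r0 r1 I)"
    unfolding sub by blast
  finally show ?thesis .
qed

lemma block_indep_cong:
  assumes "\<And>j i. j \<in> I \<Longrightarrow> y j i = z j i"
  shows "block_indep y r0 r1 I \<longleftrightarrow> block_indep z r0 r1 I"
  using assms by (simp add: block_indep_def)

text \<open>Block triangular elimination: in the rows \<open>r1..<r2\<close> the columns of
  \<open>I\<close> vanish, so the coefficients on \<open>K\<close> are zero; the rows
  \<open>r0..<r1\<close> then settle those on \<open>I\<close>.\<close>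

lemma block_indep_glue:
  assumes "finite I" "finite K" "I \<inter> K = {}" "r0 \<le> r1" "r1 \<le> r2"
    and I: "block_indep y r0 r1 I" and K: "block_indep y r1 r2 K"
    and zero: "\<And>j i. j \<in> I \<Longrightarrow> i \<in> {r1..<r2} \<Longrightarrow> y j i = 0"
  shows "block_indep y r0 r2 (I \<union> K)"
  unfolding block_indep_def
proof (intro allI impI)
  fix u assume u: "\<forall>i\<in>{r0..<r2}. (\<Sum>j\<in>I \<union> K. u j * y j i) = 0"
  have split: "(\<Sum>j\<in>I \<union> K. u j * y j i) = (\<Sum>j\<in>I. u j * y j i) + (\<Sum>j\<in>K. u j * y j i)" for i
    by (rule sum.union_disjoint[OF assms(1-3)])
  have "(\<Sum>j\<in>K. u j * y j i) = 0" if i: "i \<in> {r1..<r2}" for i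
  proof -
    have "(\<Sum>j\<in>I. u j * y j i) = 0" using zero[OF _ i] by (intro sum.neutral) simp
    moreover have "(\<Sum>j\<in>I \<union> K. u j * y j i) = 0" using u i assms(4) by simp
    ultimately show ?thesis using split[of i] by simp
  qed
  then have uK: "\<forall>j\<in>K. u j = 0" using K unfolding block_indep_def by blast
  have "(\<Sum>j\<in>I. u j * y j i) = 0" if i: "i \<in> {r0..<r1}" for i
  proof -
    have "(\<Sum>j\<in>K. u j * y j i) = 0" using uK by (intro sum.neutral) simp
    moreover have "(\<Sum>j\<in>I \<union> K. u j * y j i) = 0" using u i assms(5) by simp
    ultimately show ?thesis using split[of i] by simp
  qed
  then have "\<forall>j\<in>I. u j = 0" using I unfolding block_indep_def by blast
  then show "\<forall>j\<in>I \<union> K. u j = 0" using uK by blast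
qed

lemma family_independent_iff_block_indep:
  assumes "finite I" "\<And>j. j \<in> I \<Longrightarrow> y j \<in> low m"
  shows "fs.family_independent y I \<longleftrightarrow> block_indep y 0 m I"
proof -
  have "(\<Sum>j\<in>I. fscale (u j) (y j)) = 0 \<longleftrightarrow> (\<forall>i\<in>{0..<m}. (\<Sum>j\<in>I. u j * y j i) = 0)" for u
  proof -
    have e: "(\<Sum>j\<in>I. fscale (u j) (y j)) i = (\<Sum>j\<in>I. u j * y j i)" for i
      by (simp add: sum_fun_apply fscale_def)
    have "(\<Sum>j\<in>I. u j * y j i) = 0" if "i \<ge> m" for i
      using assms(2) that by (intro sum.neutral) (auto simp: low_def)
    then have "(\<forall>i\<in>{0..<m}. (\<Sum>j\<in>I. u j * y j i) = 0) \<longleftrightarrow> (\<forall>i. (\<Sum>j\<in>I. u j * y j i) = 0)"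
      by (auto simp: not_less intro: leI)
    then show ?thesis by (simp add: fun_eq_iff e)
  qed
  then show ?thesis unfolding fs.family_independent_iff[OF assms(1)] block_indep_def by simp
qed

lemma (in linear_families) family_independent_reindex:
  assumes "inj_on p I"
  shows "family_independent (\<lambda>j. x (p j)) I \<longleftrightarrow> family_independent x (p ` I)"
proof -
  have "inj_on (\<lambda>j. x (p j)) I \<longleftrightarrow> inj_on x (p ` I)"
    using assms comp_inj_on_iff[OF assms, of x] by (simp add: comp_def)
  then show ?thesis by (simp add: family_independent_def image_image)
qed

text \<open>\<open>Z\<close> lies in the span of the images under \<open>act S\<close> of the
  \<open>r\<close> unit vectors that span \<open>low r\<close>.\<close>

lemma dim_le_if_act_low:
  assumes R: "R \<in> carrier_mat m m" "S \<in> carrier_mat m m" "S * R = 1\<^sub>m m"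
    and Z: "\<And>x. x \<in> Z \<Longrightarrow> x \<in> low m" "\<And>x. x \<in> Z \<Longrightarrow> act R x \<in> low r"
  shows "fs.dim Z \<le> r"
proof -
  let ?W = "act S ` unitf ` {..<r}"
  have "Z \<subseteq> fs.span ?W"
  proof
    fix x assume x: "x \<in> Z"
    have "act R x \<in> fs.span (unitf ` {..<r})" using Z(2)[OF x] by (simp only: span_unitf)
    then have "act S (act R x) \<in> fs.span ?W"
      by (rule act_span_subset[rotated 2]) (auto intro: fs.span_base)
    then show "x \<in> fs.span ?W" using act_inverse[OF R Z(1)[OF x]] by simp
  qed
  then have "fs.dim Z \<le> card ?W" by (rule fs.dim_le_card) simp
  also have "\<dots> \<le> card (unitf ` {..<r} :: (nat \<Rightarrow> 'a) set)" by (rule card_image_le) simp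
  also have "\<dots> \<le> r" using card_image_le[of "{..<r}" unitf] by simp
  finally show ?thesis .
qed

section \<open>Decompositions and chains of column sets\<close>

text \<open>\<open>Y a j\<close> is the \<open>j\<close>-th column of \<open>RMQ\<close> under the completion \<open>a\<close>. The last three conjuncts say that
  the diagonal blocks are FmR.\<close>

definition triangular ::
  "('p \<Rightarrow> nat \<Rightarrow> nat \<Rightarrow> 'a::field) \<Rightarrow> nat \<Rightarrow> nat \<Rightarrow> nat \<Rightarrow> nat \<Rightarrow> nat \<Rightarrow> nat \<Rightarrow> nat \<Rightarrow> nat \<Rightarrow> bool" where
  "triangular Y m n r1 r2 r3 c1 c2 c3 \<longleftrightarrow>
     r1 + r2 + r3 = m \<and> c1 + c2 + c3 = n \<and>
     (r1 < c1 \<or> r1 = 0 \<and> c1 = 0) \<and> r2 = c2 \<and> (c3 < r3 \<or> r3 = 0 \<and> c3 = 0) \<and>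
     (\<forall>a. \<forall>j<c1. Y a j \<in> low r1) \<and> (\<forall>a. \<forall>j\<in>{c1..<c1 + c2}. Y a j \<in> low (r1 + r2)) \<and>
     (\<exists>a. \<exists>I\<subseteq>{..<c1}. card I = r1 \<and> block_indep (Y a) 0 r1 I) \<and>
     (\<exists>a. block_indep (Y a) r1 (r1 + r2) {c1..<c1 + c2}) \<and>
     (\<exists>a. block_indep (Y a) (r1 + r2) m {c1 + c2..<n})"

lemma triangular_low:
  assumes "triangular Y m n r1 r2 r3 c1 c2 c3"
  shows "j < c1 \<Longrightarrow> Y a j \<in> low r1" "j < c1 + c2 \<Longrightarrow> Y a j \<in> low (r1 + r2)"
proof -
  have l1: "\<forall>a. \<forall>j<c1. Y a j \<in> low r1"
    using assms unfolding triangular_def by (elim conjE)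
  have l2: "\<forall>a. \<forall>j\<in>{c1..<c1 + c2}. Y a j \<in> low (r1 + r2)"
    using assms unfolding triangular_def by (elim conjE)
  show "Y a j \<in> low r1" if "j < c1" using l1 that by simp
  show "Y a j \<in> low (r1 + r2)" if "j < c1 + c2"
  proof (cases "j < c1")
    case True
    then have "Y a j \<in> low r1" using l1 by simp
    then show ?thesis using low_mono[of r1 "r1 + r2"] by auto
  next
    case False
    then have "j \<in> {c1..<c1 + c2}" using that by simp
    then show ?thesis using l2 by blast
  qed
qed

text \<open>In \<open>S\<close> and \<open>T\<close> the smaller dimension is the number of columns,
  so FmR admits only the entire column range as index set. In \<open>W\<close> it is the number of
  rows, and a choice of columns remains.\<close>

lemma ex_subset_card_eq_iff:
  assumes "finite A" "card A = c"
  shows "(\<exists>I\<subseteq>A. card I = c \<and> P I) \<longleftrightarrow> P A"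
proof
  assume "\<exists>I\<subseteq>A. card I = c \<and> P I"
  then obtain I where I: "I \<subseteq> A" "card I = c" "P I" by blast
  have "I = A" using card_subset_eq[OF assms(1) I(1)] I(2) assms(2) by simp
  then show "P A" using I(3) by simp
next
  assume "P A"
  then show "\<exists>I\<subseteq>A. card I = c \<and> P I" using assms(2) by (intro exI[of _ A]) simp
qed

lemma block_decomp_iff_triangular:
  assumes M: "is_aci k M" and m: "m = aci_rows M" and n: "n = aci_cols M"
    and R: "R \<in> carrier_mat m m" "invertible_mat R" and p: "p permutes {..<n}"
  shows "block_decomp k M R (perm_mat n p) r1 r2 r3 c1 c2 c3 \<longleftrightarrow>
    triangular (\<lambda>a j. act R (compcol k M a (p j))) m n r1 r2 r3 c1 c2 c3" (is "?L \<longleftrightarrow> triangular ?Y _ _ _ _ _ _ _ _")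
\<comment> \<open>The size conditions are settled first: both sides fail without them, and with them
  the minimum in FmR is known for each block.\<close>
proof (cases "r1 + r2 + r3 = m \<and> c1 + c2 + c3 = n \<and> (r1 < c1 \<or> r1 = 0 \<and> c1 = 0) \<and> r2 = c2 \<and> (c3 < r3 \<or> r3 = 0 \<and> c3 = 0)")
  case False
  define N where "N = aci_mult R M (perm_mat n p)"
  have "\<not> ?L"
  proof
    assume ?L
    note L = this[unfolded block_decomp_def Let_def, folded m n, folded N_def]
    have sum: "r1 + r2 + r3 = m" "c1 + c2 + c3 = n" and shape: "wide_or_void (aci_block N 0 r1 0 c1)"
      "square_or_void (aci_block N r1 (r1 + r2) c1 (c1 + c2))"
      "tall_or_void (aci_block N (r1 + r2) m (c1 + c2) n)"
      using L by blast+
    have "r1 < c1 \<or> r1 = 0 \<and> c1 = 0" using shape(1) by (simp add: wide_or_void_def)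
    moreover have "r2 = c2" using shape(2) by (simp add: square_or_void_def)
    moreover have "c3 < r3 \<or> r3 = 0 \<and> c3 = 0"
      using shape(3) sum by (simp add: tall_or_void_def) linarith
    ultimately show False using False sum by blast
  qed
  moreover have "\<not> triangular ?Y m n r1 r2 r3 c1 c2 c3"
    using False unfolding triangular_def by blast
  ultimately show ?thesis by blast
next
  case True
  then have sum: "r1 + r2 + r3 = m" "c1 + c2 + c3 = n" and w: "r1 < c1 \<or> r1 = 0 \<and> c1 = 0"
    and s: "r2 = c2" and t: "c3 < r3 \<or> r3 = 0 \<and> c3 = 0" by auto
  define N where "N = aci_mult R M (perm_mat n p)"
  have N: "aci_rows N = m" "aci_cols N = n" using R by (auto simp: N_def)
  have Y: "compcol k N a j = ?Y a j" if "j < n" for a j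
    using compcol_aci_mult[of k M R p j a] M R p that by (simp add: is_aci_def m n N_def)
  have Yl: "?Y a j \<in> low m" for a j using act_low[OF R(1)] .
  have bi: "block_indep (compcol k N a) s0 s1 I \<longleftrightarrow> block_indep (?Y a) s0 s1 I" if "I \<subseteq> {..<n}" for a s0 s1 I
    using Y that by (intro block_indep_cong) auto
  have W: "FmR k (aci_block N 0 r1 0 c1) \<longleftrightarrow> (\<exists>a. \<exists>I\<subseteq>{..<c1}. card I = r1 \<and> block_indep (?Y a) 0 r1 I)"
  proof -
    have "min r1 c1 = r1" using w by auto
    then have "FmR k (aci_block N 0 r1 0 c1) \<longleftrightarrow>
        (\<exists>a. \<exists>I\<subseteq>{..<c1}. card I = r1 \<and> block_indep (compcol k N a) 0 r1 I)"
      using FmR_block_iff[of r1 N c1 k 0 0] N sum by (simp add: atLeast0LessThan)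
    moreover have "block_indep (compcol k N a) 0 r1 I \<longleftrightarrow> block_indep (?Y a) 0 r1 I" if "I \<subseteq> {..<c1}" for a I
      by (rule bi) (use that sum in auto)
    ultimately show ?thesis by auto
  qed
  have S: "FmR k (aci_block N r1 (r1 + r2) c1 (c1 + c2)) \<longleftrightarrow> (\<exists>a. block_indep (?Y a) r1 (r1 + r2) {c1..<c1 + c2})"
  proof -
    have sub: "{c1..<c1 + c2} \<subseteq> {..<n}" using sum by auto
    have "FmR k (aci_block N r1 (r1 + r2) c1 (c1 + c2)) \<longleftrightarrow>
      (\<exists>a. \<exists>I\<subseteq>{c1..<c1 + c2}. card I = c2 \<and> block_indep (compcol k N a) r1 (r1 + r2) I)"
      using FmR_block_iff[of "r1 + r2" N "c1 + c2" k r1 c1] N sum s by simp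
    also have "\<dots> \<longleftrightarrow> (\<exists>a. block_indep (compcol k N a) r1 (r1 + r2) {c1..<c1 + c2})"
      by (subst ex_subset_card_eq_iff) simp_all
    finally show ?thesis unfolding bi[OF sub] .
  qed
  have T: "FmR k (aci_block N (r1 + r2) m (c1 + c2) n) \<longleftrightarrow> (\<exists>a. block_indep (?Y a) (r1 + r2) m {c1 + c2..<n})"
  proof -
    have sub: "{c1 + c2..<n} \<subseteq> {..<n}" by auto
    have "min (m - (r1 + r2)) (n - (c1 + c2)) = n - (c1 + c2)" using sum t by auto
    then have "FmR k (aci_block N (r1 + r2) m (c1 + c2) n) \<longleftrightarrow> (\<exists>a. \<exists>I\<subseteq>{c1 + c2..<n}.
        card I = n - (c1 + c2) \<and> block_indep (compcol k N a) (r1 + r2) m I)"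
      using FmR_block_iff[of m N n k "r1 + r2" "c1 + c2"] N by simp
    also have "\<dots> \<longleftrightarrow> (\<exists>a. block_indep (compcol k N a) (r1 + r2) m {c1 + c2..<n})"
      by (subst ex_subset_card_eq_iff) simp_all
    finally show ?thesis unfolding bi[OF sub] .
  qed
  \<comment> \<open>All rows from \<open>m\<close> on are zero by padding, so a zero block that
    starts at row \<open>s0\<close> is the same as membership in \<open>low s0\<close>.\<close>
  have low: "(\<forall>i\<in>{s0..<m}. ?Y a j i = 0) \<longleftrightarrow> ?Y a j \<in> low s0" for a j s0
    using Yl[of a j] unfolding low_def by (auto simp: not_less)
  have Z1: "aci_zero k (aci_block N r1 m 0 c1) \<longleftrightarrow> (\<forall>a. \<forall>j<c1. ?Y a j \<in> low r1)"
  proof -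
    have "aci_zero k (aci_block N r1 m 0 c1) \<longleftrightarrow> (\<forall>a. \<forall>j<c1. \<forall>i\<in>{r1..<m}. compcol k N a j i = 0)"
      using aci_zero_block_iff[of m N c1 k r1 0] N sum by (simp add: atLeast0LessThan Ball_def)
    also have "\<dots> \<longleftrightarrow> (\<forall>a. \<forall>j<c1. \<forall>i\<in>{r1..<m}. ?Y a j i = 0)"
      using Y sum by simp
    finally show ?thesis unfolding low .
  qed
  have Z2: "aci_zero k (aci_block N (r1 + r2) m c1 (c1 + c2)) \<longleftrightarrow> (\<forall>a. \<forall>j\<in>{c1..<c1 + c2}. ?Y a j \<in> low (r1 + r2))"
  proof -
    have "aci_zero k (aci_block N (r1 + r2) m c1 (c1 + c2)) \<longleftrightarrow>
        (\<forall>a. \<forall>j\<in>{c1..<c1 + c2}. \<forall>i\<in>{r1 + r2..<m}. compcol k N a j i = 0)"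
      by (rule aci_zero_block_iff) (use N sum in auto)
    also have "\<dots> \<longleftrightarrow> (\<forall>a. \<forall>j\<in>{c1..<c1 + c2}. \<forall>i\<in>{r1 + r2..<m}. ?Y a j i = 0)"
      using Y sum by simp
    finally show ?thesis unfolding low .
  qed
  have "wide_or_void (aci_block N 0 r1 0 c1)" "square_or_void (aci_block N r1 (r1 + r2) c1 (c1 + c2))"
    "tall_or_void (aci_block N (r1 + r2) m (c1 + c2) n)"
    using w s t sum by (auto simp: wide_or_void_def square_or_void_def tall_or_void_def)
  moreover have "is_perm_mat n (perm_mat n p :: 'a mat)" using p by (auto simp: is_perm_mat_def)
  ultimately show ?thesis using R True
    unfolding block_decomp_def triangular_def Let_def m[symmetric] n[symmetric] N_def[symmetric] W S T Z1 Z2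
    by (simp add: conj_ac)
qed

section \<open>Permutations and bases adapted to a chain\<close>

lemma ex_chain_list:
  assumes "finite B3" "B1 \<subseteq> B2" "B2 \<subseteq> B3"
  obtains xs where "distinct xs" "set xs = B3" "(!) xs ` {..<card B1} = B1" "(!) xs ` {..<card B2} = B2"
proof -
  have "finite B2" using finite_subset[OF assms(3,1)] .
  then have fin: "finite B1" "finite (B2 - B1)" "finite (B3 - B2)"
    using finite_subset[OF assms(2)] assms(1) by auto
  obtain x1 where x1: "set x1 = B1" "distinct x1" using finite_distinct_list[OF fin(1)] by auto
  obtain x2 where x2: "set x2 = B2 - B1" "distinct x2" using finite_distinct_list[OF fin(2)] by auto
  obtain x3 where x3: "set x3 = B3 - B2" "distinct x3" using finite_distinct_list[OF fin(3)] by auto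
  define xs where "xs = x1 @ x2 @ x3"
  have l1: "length x1 = card B1" using x1 distinct_card by metis
  have "set (x1 @ x2) = B2" "distinct (x1 @ x2)" using x1 x2 assms(2) by auto
  then have l2: "length (x1 @ x2) = card B2" using distinct_card by metis
  have "(!) xs ` {..<card B1} = B1"
    using nth_image[of "card B1" xs] l1 x1(1) by (simp add: xs_def atLeast0LessThan)
  moreover have "(!) xs ` {..<card B2} = B2"
    using nth_image[of "card B2" xs] l2 \<open>set (x1 @ x2) = B2\<close> by (simp add: xs_def atLeast0LessThan)
  moreover have "distinct xs" "set xs = B3" using x1 x2 x3 assms by (auto simp: xs_def)
  ultimately show thesis using that by simp
qed

lemma ex_chain_permutes:
  assumes "J1 \<subseteq> J2" "J2 \<subseteq> {..<n::nat}"
  obtains p where "p permutes {..<n}" "p ` {..<card J1} = J1" "p ` {..<card J2} = J2"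
proof -
  obtain xs where xs: "distinct xs" "set xs = {..<n}" "(!) xs ` {..<card J1} = J1" "(!) xs ` {..<card J2} = J2"
    using ex_chain_list[OF _ assms] by auto
  have len: "length xs = n" using distinct_card[OF xs(1)] xs(2) by simp
  have le: "card J2 \<le> n" using card_mono[OF _ assms(2)] by simp
  have le1: "card J1 \<le> card J2" using card_mono[OF _ assms(1)] finite_subset[OF assms(2)] by simp
  define p where "p j = (if j < n then xs ! j else j)" for j
  have "bij_betw p {..<n} {..<n}"
    using bij_betw_nth[OF xs(1) _ xs(2)[symmetric], of "{..<n}"] len
    by (subst bij_betw_cong[of _ _ "(!) xs"]) (auto simp: p_def)
  then have "p permutes {..<n}" by (rule bij_imp_permutes) (simp add: p_def)
  moreover have "p ` {..<card J1} = (!) xs ` {..<card J1}" "p ` {..<card J2} = (!) xs ` {..<card J2}"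
    using le le1 by (auto simp: p_def intro!: image_cong)
  ultimately show thesis using that xs(3,4) by simp
qed

text \<open>\<open>S\<close> has the basis vectors as columns, hence maps the unit vectors to them,
  and \<open>R\<close> is its inverse. A zero determinant would give a dependency of the
  basis.\<close>

lemma ex_invertible_mat_of_basis:
  assumes B: "fs.family_independent b {..<m}" "\<And>j. j < m \<Longrightarrow> b j \<in> low m"
  obtains R S where "R \<in> carrier_mat m m" "S \<in> carrier_mat m m" "R * S = 1\<^sub>m m" "S * R = 1\<^sub>m m"
    "\<forall>j<m. act R (b j) = unitf j"
proof -
  define S where "S = mat m m (\<lambda>(i, j). b j i)"
  have S: "S \<in> carrier_mat m m" by (simp add: S_def)
  have cS: "colf S j = b j" if "j < m" for j
    using B(2)[OF that] that by (auto simp: colf_def S_def low_def fun_eq_iff)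
  have "fs.family_independent (colf S) {..<m}"
  proof -
    have "colf S ` {..<m} = b ` {..<m}" using cS by auto
    moreover have "inj_on (colf S) {..<m} \<longleftrightarrow> inj_on b {..<m}" by (rule inj_on_cong) (simp add: cS)
    ultimately show ?thesis using B(1) by (simp add: fs.family_independent_def)
  qed
  then have ind: "\<forall>j\<in>{..<m}. u j = 0" if "\<forall>i<m. (\<Sum>j<m. u j * S $$ (i, j)) = 0" for u
    using that S unfolding colf_family_independent_iff[OF finite_lessThan] by simp
  have "det S \<noteq> 0"
  proof
    assume "det S = 0"
    then obtain v where v: "v \<in> carrier_vec m" "v \<noteq> 0\<^sub>v m" "S *\<^sub>v v = 0\<^sub>v m"
      using det_0_iff_vec_prod_zero_field[OF S] by auto
    have "(\<Sum>j<m. v $ j * S $$ (i, j)) = 0" if "i < m" for i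
    proof -
      have "(S *\<^sub>v v) $ i = (\<Sum>j<m. v $ j * S $$ (i, j))"
        using that S v(1) by (simp add: scalar_prod_def atLeast0LessThan mult.commute)
      then show ?thesis using v(3) that by simp
    qed
    then have "\<forall>j\<in>{..<m}. v $ j = 0" by (intro ind) simp
    then have "v = 0\<^sub>v m" using v(1) by (intro eq_vecI) auto
    then show False using v(2) by simp
  qed
  then have "S \<in> Units (ring_mat TYPE('a) m ())" by (rule det_non_zero_imp_unit[OF S])
  then obtain R where R: "R \<in> carrier_mat m m" "R * S = 1\<^sub>m m" "S * R = 1\<^sub>m m"
    unfolding Units_def by (auto simp: ring_mat_simps)
  have "act R (b j) = unitf j" if j: "j < m" for j
  proof -
    have "act S (unitf j) = b j"
      using cS[OF j] S j by (auto simp: act_def unitf_def colf_def fun_eq_iff if_distrib[of "\<lambda>c. _ * c"] cong: if_cong)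
    moreover have "act R (act S (unitf j)) = unitf j"
      using j by (intro act_inverse[OF S R(1,2)]) (auto simp: low_def unitf_def)
    ultimately show ?thesis by simp
  qed
  then show thesis using that[OF R(1) S R(2,3)] by simp
qed

text \<open>A basis for \<open>V1\<close> is extended to one for \<open>V2\<close> and then to one
  of \<open>low m\<close>. In the coordinates of this basis, ordered along the chain, each of the
  two sets occupies leading coordinates. Only spans matter, so \<open>V1\<close> and
  \<open>V2\<close> may be sets of column values.\<close>

lemma ex_adapted_mat:
  assumes V: "V1 \<subseteq> V2" "V2 \<subseteq> low m"
  obtains R S where "R \<in> carrier_mat m m" "S \<in> carrier_mat m m" "R * S = 1\<^sub>m m" "S * R = 1\<^sub>m m"
    "\<forall>x\<in>V1. act R x \<in> low (fs.dim V1)" "\<forall>x\<in>V2. act R x \<in> low (fs.dim V2)"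
proof -
  note E = finite_unitf[of m] low_subset_span[of m]
  have V1: "V1 \<subseteq> fs.span (unitf ` {..<m})" and V2: "V2 \<subseteq> fs.span (unitf ` {..<m})"
    using V by (auto simp: span_unitf)
  obtain B1 where B1: "B1 \<subseteq> V1" "fs.independent B1" "V1 \<subseteq> fs.span B1" "card B1 = fs.dim V1"
    by (rule fs.basis_exists)
  obtain B2 where B2: "B1 \<subseteq> B2" "B2 \<subseteq> V2" "fs.independent B2" "V2 \<subseteq> fs.span B2" "card B2 = fs.dim V2"
    using fs.finite_basis_extend[OF E(1) V2 subset_trans[OF B1(1) V(1)] B1(2)] by blast
  obtain B3 where B3: "B2 \<subseteq> B3" "B3 \<subseteq> low m" "fs.independent B3" "finite B3"
      "card B3 = fs.dim (low m :: (nat \<Rightarrow> 'a) set)"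
    using fs.finite_basis_extend[OF E subset_trans[OF B2(2) V(2)] B2(3)] by blast
  obtain xs where xs: "distinct xs" "set xs = B3" "(!) xs ` {..<card B1} = B1" "(!) xs ` {..<card B2} = B2"
    by (rule ex_chain_list[OF B3(4) B2(1) B3(1)])
  have len: "length xs = m" using distinct_card[OF xs(1)] xs(2) B3(5) by (simp add: dim_low)
  have im: "(!) xs ` {..<m} = B3" using nth_image[of m xs] len xs(2) by (simp add: atLeast0LessThan)
  have ind: "fs.family_independent ((!) xs) {..<m}"
    using B3(3) inj_on_nth[OF xs(1), of "{..<m}"] len by (simp add: fs.family_independent_def im)
  have le: "card B1 \<le> m" "card B2 \<le> m"
    using card_mono[OF B3(4)] B2(1) B3(1,5) by (auto simp: dim_low)
  have xl: "xs ! j \<in> low m" if "j < m" for j using im B3(2) that by auto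
  obtain R S where R: "R \<in> carrier_mat m m" "S \<in> carrier_mat m m" "R * S = 1\<^sub>m m" "S * R = 1\<^sub>m m"
    and act: "\<forall>j<m. act R (xs ! j) = unitf j"
    by (rule ex_invertible_mat_of_basis[OF ind xl])
  have low: "act R x \<in> low (card B)" if B: "B = (!) xs ` {..<card B}" "card B \<le> m" "x \<in> fs.span B" for B x
  proof (rule act_span_subset[OF _ subspace_low B(3)])
    fix y assume "y \<in> B"
    then obtain j where j: "j < card B" "y = xs ! j" using equalityD1[OF B(1)] by auto
    then have "act R y = unitf j" using act B(2) by simp
    then show "act R y \<in> low (card B)" using j by (auto simp: low_def unitf_def)
  qed
  show thesis
  proof (rule that[OF R])
    show "\<forall>x\<in>V1. act R x \<in> low (fs.dim V1)"
      using low[OF xs(3)[symmetric] le(1)] B1(3,4) by auto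
    show "\<forall>x\<in>V2. act R x \<in> low (fs.dim V2)"
      using low[OF xs(4)[symmetric] le(2)] B2(4,5) by auto
  qed
qed

text \<open>The independent columns with index in \<open>I\<close> already span all of \<open>low r0\<close>, so a dependency of the block
  columns modulo \<open>low r0\<close> would extend to a dependency of the full columns.\<close>

lemma block_indepI:
  assumes "finite I" "finite K" "I \<inter> K = {}" "fs.family_independent y (I \<union> K)"
    and I: "\<And>j. j \<in> I \<Longrightarrow> y j \<in> low r0" "card I = r0" and K: "\<And>j. j \<in> K \<Longrightarrow> y j \<in> low r1"
  shows "block_indep y r0 r1 K"
  unfolding block_indep_def
proof (intro allI impI)
  fix u assume u: "\<forall>i\<in>{r0..<r1}. (\<Sum>j\<in>K. u j * y j i) = 0"
  define z where "z = (\<Sum>j\<in>K. fscale (u j) (y j))"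
  have zi: "z i = (\<Sum>j\<in>K. u j * y j i)" for i by (simp add: z_def sum_fun_apply fscale_def)
  have "z i = 0" if "i \<ge> r0" for i
  proof (cases "i < r1")
    case False
    then show ?thesis unfolding zi using K by (intro sum.neutral) (auto simp: low_def)
  qed (use u that zi in auto)
  then have "z \<in> low r0" by (simp add: low_def)
  moreover have indI: "fs.family_independent y I" by (rule fs.family_independent_mono[OF assms(4)]) simp
  have "low r0 \<subseteq> fs.span (y ` I)"
    by (rule fs.family_independent_spans[OF finite_unitf low_subset_span _ indI])
      (use I in \<open>auto simp: dim_low\<close>)
  ultimately have "z \<in> fs.span (y ` I)" by blast
  then obtain w where "z = (\<Sum>v\<in>y ` I. fscale (w v) v)"
    using fs.span_finite[of "y ` I"] assms(1) by auto
  also have "\<dots> = (\<Sum>j\<in>I. fscale (w (y j)) (y j))"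
    using indI by (simp add: fs.family_independent_def sum.reindex)
  finally have zI: "z = (\<Sum>j\<in>I. fscale (w (y j)) (y j))" .
  define t where "t j = (if j \<in> K then u j else - w (y j))" for j
  have "(\<Sum>j\<in>I \<union> K. fscale (t j) (y j)) = (\<Sum>j\<in>I. fscale (t j) (y j)) + (\<Sum>j\<in>K. fscale (t j) (y j))"
    by (rule sum.union_disjoint[OF assms(1-3)])
  also have "(\<Sum>j\<in>K. fscale (t j) (y j)) = z" unfolding z_def by (rule sum.cong) (simp_all add: t_def)
  also have "(\<Sum>j\<in>I. fscale (t j) (y j)) = (\<Sum>j\<in>I. - fscale (w (y j)) (y j))"
    using assms(3) by (intro sum.cong refl) (auto simp: t_def fscale_def fun_eq_iff)
  also have "\<dots> = - z" unfolding zI by (rule sum_negf)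
  finally have "(\<Sum>j\<in>I \<union> K. fscale (t j) (y j)) = 0" by (simp only: left_minus)
  then have t0: "\<forall>j\<in>I \<union> K. t j = 0"
    using assms(4) fs.family_independent_iff[of "I \<union> K" y] assms(1,2) by simp
  show "\<forall>j\<in>K. u j = 0"
  proof
    fix j assume j: "j \<in> K"
    then have "t j = 0" using t0 by simp
    then show "u j = 0" using j by (simp add: t_def)
  qed
qed

text \<open>\<open>X a j\<close> plays the column \<open>j\<close> under the completion
  \<open>a\<close>. The assumption \<open>X_mix\<close>, that columns can be completed
  independently, is all that remains of the ACI condition.\<close>

locale column_family =
  fixes X :: "'p \<Rightarrow> nat \<Rightarrow> nat \<Rightarrow> 'a::field" and m n :: nat
  assumes X_low: "X a j \<in> low m"
    and X_mix: "\<exists>a. \<forall>j<n. X a j = X (b j) j"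
begin

definition colvals :: "nat set \<Rightarrow> (nat \<Rightarrow> 'a) set" where
  "colvals J = (\<Union>j\<in>J. range (\<lambda>a. X a j))"

definition colrank :: "nat set \<Rightarrow> nat" where
  "colrank J = fs.dim (colvals J)"

lemma colvals_low: "colvals J \<subseteq> low m"
  using X_low by (auto simp: colvals_def)

lemma colvals_span: "colvals J \<subseteq> fs.span (unitf ` {..<m})"
  using colvals_low by (simp only: span_unitf)

lemma colvals_mono: "J \<subseteq> K \<Longrightarrow> colvals J \<subseteq> colvals K"
  by (auto simp: colvals_def)

lemma colvals_Un: "colvals (J \<union> K) = colvals J \<union> colvals K"
  by (auto simp: colvals_def)

lemma colrank_le: "colrank J \<le> m"
  using fs.dim_mono_finite[OF finite_unitf low_subset_span subset_trans[OF colvals_low fs.span_superset]]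
  by (simp add: colrank_def dim_low)

lemma colrank_submodular: "colrank (J \<union> K) + colrank (J \<inter> K) \<le> colrank J + colrank K"
  unfolding colrank_def colvals_Un
  by (intro fs.dim_submodular[OF finite_unitf colvals_span colvals_span] colvals_mono) auto

lemma card_le_colrank:
  assumes "K \<subseteq> J" "fs.family_independent (X a) K"
  shows "card K \<le> colrank J"
  unfolding colrank_def
  by (rule fs.family_independent_card_le_dim[OF finite_unitf colvals_span _ assms(2)])
    (use assms(1) in \<open>auto simp: colvals_def\<close>)

text \<open>Gluing the three FmR blocks gives one completion with \<open>r1 + (n - c1)\<close>
  independent columns. A set \<open>J\<close> misses at most \<open>c1 - r1\<close> of its columns,
  which bounds \<open>card J - colrank J\<close>; the zero blocks show that both leading column sets
  attain this bound.\<close>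

lemma triangular_imp_chain:
  assumes R: "R \<in> carrier_mat m m" "S \<in> carrier_mat m m" "S * R = 1\<^sub>m m" and p: "p permutes {..<n}"
    and tri: "triangular (\<lambda>a j. act R (X a (p j))) m n r1 r2 r3 c1 c2 c3"
  shows "colrank (p ` {..<c1}) = r1" "colrank (p ` {..<c1 + c2}) = r1 + r2"
    "\<And>J. J \<subseteq> {..<n} \<Longrightarrow> card J + r1 \<le> colrank J + c1"
proof -
  define Y where "Y = (\<lambda>a j. act R (X a (p j)))"
  note tri' = tri[folded Y_def, unfolded triangular_def]
  have sum: "r1 + r2 + r3 = m" "c1 + c2 + c3 = n" "r2 = c2" and w: "r1 \<le> c1" using tri' by auto
  note low1 = triangular_low(1)[OF tri[folded Y_def]] and low12 = triangular_low(2)[OF tri[folded Y_def]]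
  obtain aW IW where W: "IW \<subseteq> {..<c1}" "card IW = r1" "block_indep (Y aW) 0 r1 IW" using tri' by auto
  obtain aS where S': "block_indep (Y aS) r1 (r1 + r2) {c1..<c1 + c2}" using tri' by auto
  obtain aT where T: "block_indep (Y aT) (r1 + r2) m {c1 + c2..<n}" using tri' by auto
  \<comment> \<open>\<open>inv_into UNIV p j\<close> is the position of column \<open>j\<close>
    after the permutation. Each column takes the completion that serves the block containing this
    position.\<close>
  define b where "b j = (let i = inv_into UNIV p j in if i < c1 then aW else if i < c1 + c2 then aS else aT)" for j
  obtain a where a: "\<forall>j<n. X a j = X (b j) j" using X_mix by blast
  have pinv: "inv_into UNIV p (p j) = j" for j using permutes_inverses(2)[OF p] .
  have pn: "p j < n" if "j < n" for j using permutes_in_image[OF p, of j] that by simp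
  have Ya: "Y a j = Y (if j < c1 then aW else if j < c1 + c2 then aS else aT) j" if "j < n" for j
    unfolding Y_def using a[rule_format, OF pn[OF that]] by (simp add: b_def pinv Let_def)
  have finW: "finite IW" using finite_subset[OF W(1)] by simp
  have bW: "block_indep (Y a) 0 r1 IW"
  proof -
    have "Y a j = Y aW j" if "j \<in> IW" for j using Ya[of j] W(1) that sum by auto
    then show ?thesis using W(3) block_indep_cong[of IW "Y a" "Y aW"] by simp
  qed
  have bS: "block_indep (Y a) r1 (r1 + r2) {c1..<c1 + c2}"
  proof -
    have "Y a j = Y aS j" if "j \<in> {c1..<c1 + c2}" for j using Ya[of j] that sum by auto
    then show ?thesis using S' block_indep_cong[of "{c1..<c1 + c2}" "Y a" "Y aS"] by simp
  qed
  have bT: "block_indep (Y a) (r1 + r2) m {c1 + c2..<n}"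
  proof -
    have "Y a j = Y aT j" if "j \<in> {c1 + c2..<n}" for j using Ya[of j] that sum by auto
    then show ?thesis using T block_indep_cong[of "{c1 + c2..<n}" "Y a" "Y aT"] by simp
  qed
  have z1: "Y a j i = 0" if "j \<in> IW" "i \<in> {r1..<r1 + r2}" for i j
    using low1[of j a] W(1) that by (auto simp: low_def)
  have bWS: "block_indep (Y a) 0 (r1 + r2) (IW \<union> {c1..<c1 + c2})"
    by (rule block_indep_glue[OF finW _ _ _ _ bW bS z1]) (use W(1) in auto)
  have z2: "Y a j i = 0" if "j \<in> IW \<union> {c1..<c1 + c2}" "i \<in> {r1 + r2..<m}" for i j
  proof -
    have "j < c1 + c2" using that(1) W(1) by auto
    then show ?thesis using low12[of j a] that(2) by (simp add: low_def)
  qed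
  have "block_indep (Y a) 0 m (IW \<union> {c1..<c1 + c2} \<union> {c1 + c2..<n})"
    by (rule block_indep_glue[OF _ _ _ _ _ bWS bT z2]) (use W(1) finW sum in auto)
  moreover have "IW \<union> {c1..<c1 + c2} \<union> {c1 + c2..<n} = IW \<union> {c1..<n}" using sum by auto
  ultimately have bI: "block_indep (Y a) 0 m (IW \<union> {c1..<n})" by simp
  \<comment> \<open>All columns of \<open>S\<close> and \<open>T\<close>, together with
    \<open>r1\<close> independent ones of \<open>W\<close>.\<close>
  define I where "I = IW \<union> {c1..<n}"
  have I: "finite I" "I \<subseteq> {..<n}" using finW W(1) sum by (auto simp: I_def)
  have cI: "card I = r1 + (n - c1)"
    unfolding I_def using W(1,2) finW by (subst card_Un_disjoint) auto
  have "fs.family_independent (Y a) I"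
    using family_independent_iff_block_indep[OF I(1), of "Y a" m] bI act_low[OF R(1)]
    by (simp add: I_def Y_def)
  then have "fs.family_independent (\<lambda>j. X a (p j)) I"
    using family_independent_act[OF R I(1), of "\<lambda>j. X a (p j)"] X_low by (simp add: Y_def)
  moreover have inj: "inj_on p K" for K using permutes_inj[OF p] by (rule inj_on_subset) simp
  ultimately have ind: "fs.family_independent (X a) (p ` I)"
    using fs.family_independent_reindex[OF inj[of I], of "X a"] by simp
  have pI: "p ` I \<subseteq> {..<n}" using I(2) pn by auto
  show bound: "card J + r1 \<le> colrank J + c1" if J: "J \<subseteq> {..<n}" for J
  proof -
    have "card (J \<inter> p ` I) \<le> colrank J"
      by (rule card_le_colrank[OF _ fs.family_independent_mono[OF ind]]) auto
    moreover have "card J \<le> card (J \<inter> p ` I) + card ({..<n} - p ` I)"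
    proof -
      have "card J \<le> card ((J \<inter> p ` I) \<union> ({..<n} - p ` I))"
        using J I(1) by (intro card_mono) auto
      also have "\<dots> \<le> card (J \<inter> p ` I) + card ({..<n} - p ` I)" by (rule card_Un_le)
      finally show ?thesis .
    qed
    moreover have "card ({..<n} - p ` I) = n - card I"
      using card_Diff_subset[OF _ pI] I(1) card_image[OF inj[of I]] by simp
    ultimately show ?thesis using cI w sum by linarith
  qed
  \<comment> \<open>The zeros from row \<open>r\<close> on bound the rank from above;
    \<open>bound\<close> for the same column set bounds it from below.\<close>
  have le: "colrank (p ` {..<c}) \<le> r" if "\<And>a j. j < c \<Longrightarrow> Y a j \<in> low r" for c r
    unfolding colrank_def
    by (rule dim_le_if_act_low[OF R]) (use that X_low in \<open>auto simp: colvals_def Y_def\<close>)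
  have cp: "card (p ` {..<c}) = c" for c using card_image[OF inj[of "{..<c}"]] by simp
  have pc: "p ` {..<c} \<subseteq> {..<n}" if "c \<le> n" for c using pn that by auto
  show "colrank (p ` {..<c1}) = r1"
    using le[of c1 r1] low1 bound[OF pc[of c1]] cp[of c1] sum by simp
  show "colrank (p ` {..<c1 + c2}) = r1 + r2"
    using le[of "c1 + c2" "r1 + r2"] low12 bound[OF pc[of "c1 + c2"]] cp[of "c1 + c2"] sum by simp
qed

text \<open>Coordinates adapted to the values of the columns in \<open>J1\<close> and
  \<open>J2\<close> produce the zero blocks. FmR comes from a single completion: with at least
  \<open>n - d\<close> independent columns no block has any slack.\<close>

lemma chain_imp_triangular:
  assumes J: "J1 \<subseteq> J2" "J2 \<subseteq> {..<n}"
    and d: "\<And>J. J \<subseteq> {..<n} \<Longrightarrow> card J \<le> colrank J + d"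
    and J1: "colrank J1 + d = card J1" and J2: "colrank J2 + d = card J2"
    and wide: "colrank J1 < card J1 \<or> card J1 = 0"
    and tall: "n - card J2 < m - colrank J2 \<or> card J2 = n \<and> colrank J2 = m"
  obtains R p where "R \<in> carrier_mat m m" "invertible_mat R" "p permutes {..<n}"
    "triangular (\<lambda>a j. act R (X a (p j))) m n (colrank J1) (card J2 - card J1) (m - colrank J2)
       (card J1) (card J2 - card J1) (n - card J2)"
proof -
  define c1 where "c1 = card J1"
  define c2 where "c2 = card J2"
  define r1 where "r1 = colrank J1"
  define r2 where "r2 = colrank J2"
  have fin2: "finite J2" using finite_subset[OF J(2)] by simp
  have c12: "c1 \<le> c2" unfolding c1_def c2_def using card_mono[OF fin2 J(1)] .
  have c2n: "c2 \<le> n" unfolding c2_def using card_mono[OF _ J(2)] by simp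
  have rc: "r1 + d = c1" "r2 + d = c2" using J1 J2 by (simp_all add: r1_def r2_def c1_def c2_def)
  have r2m: "r2 \<le> m" unfolding r2_def by (rule colrank_le)
  obtain p where p: "p permutes {..<n}" "p ` {..<c1} = J1" "p ` {..<c2} = J2"
    unfolding c1_def c2_def by (rule ex_chain_permutes[OF J])
  obtain R S where R: "R \<in> carrier_mat m m" "S \<in> carrier_mat m m" "R * S = 1\<^sub>m m" "S * R = 1\<^sub>m m"
    and R1: "\<forall>x\<in>colvals J1. act R x \<in> low r1" and R2: "\<forall>x\<in>colvals J2. act R x \<in> low r2"
    unfolding r1_def r2_def colrank_def by (rule ex_adapted_mat[OF colvals_mono[OF J(1)] colvals_low])
  define Y where "Y = (\<lambda>a j. act R (X a (p j)))"
  have Y1: "Y a j \<in> low r1" if "j < c1" for a j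
    unfolding Y_def using p(2) that by (intro bspec[OF R1]) (auto simp: colvals_def)
  have Y2: "Y a j \<in> low r2" if "j < c2" for a j
    unfolding Y_def using p(3) that by (intro bspec[OF R2]) (auto simp: colvals_def)
  have Ym: "Y a j \<in> low m" for a j unfolding Y_def by (rule act_low[OF R(1)])
  have "\<exists>x. (\<forall>i\<in>{..<n}. x i \<in> range (\<lambda>a. X a i)) \<and>
      (\<exists>I\<subseteq>{..<n}. fs.family_independent x I \<and> card {..<n} \<le> card I + d)"
  proof (rule fs.rado_defect)
    show "range (\<lambda>a. X a i) \<subseteq> fs.span (unitf ` {..<m})" for i
      using colvals_span[of "{i}"] by (simp add: colvals_def)
    show "card K \<le> fs.dim (\<Union>i\<in>K. range (\<lambda>a. X a i)) + d" if "K \<subseteq> {..<n}" for K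
      using d[OF that] by (simp add: colrank_def colvals_def)
  qed auto
  then obtain x I where x: "\<forall>i\<in>{..<n}. x i \<in> range (\<lambda>a. X a i)" and I: "I \<subseteq> {..<n}"
    "fs.family_independent x I" "n \<le> card I + d" by auto
  have "\<forall>i. \<exists>a. i < n \<longrightarrow> x i = X a i" using x by auto
  then obtain b where b: "\<And>i. i < n \<Longrightarrow> x i = X (b i) i" by metis
  obtain a where "\<forall>j<n. X a j = X (b j) j" using X_mix by blast
  then have a: "x j = X a j" if "j \<in> {..<n}" for j using b that by simp
  \<comment> \<open>\<open>I\<close> consists of original column indices, \<open>K\<close> of their
    positions after the permutation.\<close>
  define K where "K = p -` I"
  have pK: "p ` K = I" unfolding K_def by (rule surj_image_vimage_eq[OF permutes_surj[OF p(1)]])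
  have Kn: "K \<subseteq> {..<n}"
  proof
    fix j assume "j \<in> K"
    then have "p j \<in> {..<n}" using I(1) by (auto simp: K_def)
    then show "j \<in> {..<n}" using permutes_in_image[OF p(1)] by simp
  qed
  have finK: "finite K" using finite_subset[OF Kn] by simp
  have inj: "inj_on p L" for L using permutes_inj[OF p(1)] by (rule inj_on_subset) simp
  have cK: "card K = card I" using card_image[OF inj[of K]] pK by simp
  have "fs.family_independent (X a) I"
  proof -
    have "x ` I = X a ` I" using a I(1) by (intro image_cong) auto
    moreover have "inj_on x I \<longleftrightarrow> inj_on (X a) I" using a I(1) by (intro inj_on_cong) auto
    ultimately show ?thesis using I(2) by (simp add: fs.family_independent_def)
  qed
  then have "fs.family_independent (\<lambda>j. X a (p j)) K"
    using fs.family_independent_reindex[OF inj[of K], of "X a"] pK by simp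
  then have ind: "fs.family_independent (Y a) K"
    using family_independent_act[OF R(1,2,4) finK, of "\<lambda>j. X a (p j)"] X_low by (simp add: Y_def)
  define K1 where "K1 = K \<inter> {..<c1}"
  have fin1: "finite K1" "K1 \<subseteq> {..<c1}" by (auto simp: K1_def)
  have "card K1 \<le> fs.dim (low r1 :: (nat \<Rightarrow> 'a) set)"
    by (rule fs.family_independent_card_le_dim[OF finite_unitf low_subset_span _
          fs.family_independent_mono[OF ind]]) (use Y1 in \<open>auto simp: K1_def\<close>)
  then have k1: "card K1 \<le> r1" by (simp add: dim_low)
  have "K = K1 \<union> (K \<inter> {c1..<n})" using Kn by (auto simp: K1_def)
  then have "card K = card (K1 \<union> (K \<inter> {c1..<n}))" by simp
  also have "\<dots> = card K1 + card (K \<inter> {c1..<n})" using fin1 finK by (intro card_Un_disjoint) auto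
  finally have ck: "card K = card K1 + card (K \<inter> {c1..<n})" .
  have k2: "card (K \<inter> {c1..<n}) \<le> card {c1..<n}" by (rule card_mono) auto
  \<comment> \<open>The first \<open>c1\<close> positions contribute at most \<open>r1\<close>, the
    others at most \<open>n - c1\<close>, and the total is at least
    \<open>n - d = r1 + (n - c1)\<close>; so both bounds are attained.\<close>
  have K1: "card K1 = r1" and k3: "card (K \<inter> {c1..<n}) = card {c1..<n}"
    using ck k1 k2 cK I(3) rc c12 c2n by (simp_all)
  have sub: "{c1..<n} \<subseteq> K" using card_subset_eq[OF _ _ k3] by auto
  \<comment> \<open>The columns that precede a block are \<open>{}\<close> for \<open>W\<close>,
    \<open>K1\<close> for \<open>S\<close>, and \<open>K1\<close> with the columns of
    \<open>S\<close> for \<open>T\<close>. In each case their number equals the number of rows above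
    the block, as \<open>block_indepI\<close> demands.\<close>
  have W: "block_indep (Y a) 0 r1 K1"
    by (rule block_indepI[of "{}"])
      (use fin1 Y1 in \<open>auto simp: K1_def intro: fs.family_independent_mono[OF ind]\<close>)
  have S': "block_indep (Y a) r1 r2 {c1..<c2}"
  proof (rule block_indepI[of K1])
    show "fs.family_independent (Y a) (K1 \<union> {c1..<c2})"
      by (rule fs.family_independent_mono[OF ind]) (use sub c2n in \<open>auto simp: K1_def\<close>)
    show "Y a j \<in> low r1" if "j \<in> K1" for j using Y1 that by (simp add: K1_def)
    show "Y a j \<in> low r2" if "j \<in> {c1..<c2}" for j using Y2 that by simp
  qed (use fin1 K1 in auto)
  have T: "block_indep (Y a) r2 m {c2..<n}"
  proof (rule block_indepI[of "K1 \<union> {c1..<c2}"])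
    show "fs.family_independent (Y a) ((K1 \<union> {c1..<c2}) \<union> {c2..<n})"
      by (rule fs.family_independent_mono[OF ind]) (use sub c12 c2n in \<open>auto simp: K1_def\<close>)
    show "Y a j \<in> low r2" if "j \<in> K1 \<union> {c1..<c2}" for j using Y2 fin1(2) that c12 by auto
    have "card (K1 \<union> {c1..<c2}) = card K1 + card {c1..<c2}" using fin1 by (intro card_Un_disjoint) auto
    then show "card (K1 \<union> {c1..<c2}) = r2" using K1 rc c12 by simp
  qed (use fin1 c12 Ym in auto)
  have r2': "r1 + (c2 - c1) = r2" and c2': "c1 + (c2 - c1) = c2" using rc c12 by auto
  have "triangular Y m n r1 (c2 - c1) (m - r2) c1 (c2 - c1) (n - c2)"
    unfolding triangular_def r2' c2'
  proof (intro conjI)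
    show "r1 < c1 \<or> r1 = 0 \<and> c1 = 0" using wide rc by (auto simp: r1_def c1_def)
    show "n - c2 < m - r2 \<or> m - r2 = 0 \<and> n - c2 = 0" using tall by (auto simp: r2_def c2_def)
    show "\<exists>a. \<exists>I\<subseteq>{..<c1}. card I = r1 \<and> block_indep (Y a) 0 r1 I"
      using W K1 fin1(2) by (intro exI[of _ a] exI[of _ K1]) simp
    show "\<exists>a. block_indep (Y a) r1 r2 {c1..<c2}" using S' by (rule exI)
    show "\<exists>a. block_indep (Y a) r2 m {c2..<n}" using T by (rule exI)
  qed (use r2m c2n Y1 Y2 in auto)
  then show thesis using that[OF R(1) invertible_matI[OF R] p(1)]
    by (simp only: Y_def r1_def r2_def c1_def c2_def)
qed

end

section \<open>Uniqueness\<close>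

lemma dim_le_dim_act_image:
  assumes R: "R \<in> carrier_mat m m" "S \<in> carrier_mat m m" "S * R = 1\<^sub>m m" and Z: "Z \<subseteq> low m"
  shows "fs.dim Z \<le> fs.dim (act R ` Z)"
proof -
  obtain B where B: "B \<subseteq> Z" "fs.independent B" "finite B" "card B = fs.dim Z"
    using fs.finite_basis_extend[OF finite_unitf subset_trans[OF Z low_subset_span] empty_subsetI
        fs.independent_empty] by blast
  have "fs.family_independent (\<lambda>x. x) B" using B(2) by (simp add: fs.family_independent_def)
  then have ind: "fs.family_independent (act R) B"
    using family_independent_act[OF R B(3), of "\<lambda>x. x"] B(1) Z by auto
  have "act R ` Z \<subseteq> fs.span (unitf ` {..<m})" using act_low[OF R(1)] by (auto simp: span_unitf)
  from fs.family_independent_card_le_dim[OF finite_unitf this _ ind] B(1,4)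
  show ?thesis by auto
qed

text \<open>\<open>act R\<close> sends \<open>Z\<close> into \<open>low r\<close>, and by dimension
  the images span \<open>low r\<close>. On such an image \<open>act R z\<close>, the matrix
  \<open>S\<close> returns \<open>z\<close>, which \<open>R'\<close> sends into \<open>low r\<close>
  again.\<close>

lemma act_change_of_basis_low:
  assumes R: "R \<in> carrier_mat m m" "S \<in> carrier_mat m m" "S * R = 1\<^sub>m m" and R': "R' \<in> carrier_mat m m"
    and Z: "Z \<subseteq> low m" "fs.dim Z = r"
    and low: "\<And>z. z \<in> Z \<Longrightarrow> act R z \<in> low r" "\<And>z. z \<in> Z \<Longrightarrow> act R' z \<in> low r"
    and x: "x \<in> low r"
  shows "act (R' * S) x \<in> low r"
proof (rule act_span_subset[OF _ subspace_low])
  have "act R ` Z \<subseteq> low r" using low(1) by auto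
  moreover have "fs.dim (low r :: (nat \<Rightarrow> 'a) set) \<le> fs.dim (act R ` Z)"
    using dim_le_dim_act_image[OF R Z(1)] Z(2) by (simp add: dim_low)
  ultimately have "low r \<subseteq> fs.span (act R ` Z)"
    by (rule fs.subset_span_if_dim_le[OF finite_unitf low_subset_span])
  then show "x \<in> fs.span (act R ` Z)" using x by (rule subsetD)
  fix y assume "y \<in> act R ` Z"
  then obtain z where z: "z \<in> Z" "y = act R z" by auto
  have "z \<in> low m" using z(1) Z(1) by (rule subsetD[rotated])
  then have "act S y = z" unfolding z(2) by (rule act_inverse[OF R])
  then show "act (R' * S) y \<in> low r"
    using act_mult[OF R' R(2), of y] low(2)[OF z(1)] by simp
qed

section \<open>Diagonal blocks of a block triangular change of basis\<close>

lemma mat_zero_if_act_low: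
  assumes "G \<in> carrier_mat m m" "\<And>x. x \<in> low r \<Longrightarrow> act G x \<in> low r" "l < r" "r \<le> i" "i < m"
  shows "G $$ (i, l) = 0"
proof (cases "l < m")
  case True
  have "act G (unitf l) i = 0"
    using assms(2)[of "unitf l"] assms(3,4) by (auto simp: low_def unitf_def)
  then show ?thesis using assms(1,5) True
    by (simp add: act_def unitf_def if_distrib[of "\<lambda>c. _ * c"] cong: if_cong)
qed (use assms in auto)

lemma sum_shift_lessThan: "(\<Sum>l<d - c. g (l + c)) = (\<Sum>l\<in>{c..<d}. g l)"
  for g :: "nat \<Rightarrow> 'a::comm_monoid_add"
  unfolding image_shift_lessThan[symmetric, of c d] by (simp add: sum.reindex)

definition diag_block :: "'a mat \<Rightarrow> nat \<Rightarrow> nat \<Rightarrow> 'a mat" where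
  "diag_block G r0 r1 = mat (r1 - r0) (r1 - r0) (\<lambda>(i, j). G $$ (i + r0, j + r0))"

lemma diag_block_carrier: "diag_block G r0 r1 \<in> carrier_mat (r1 - r0) (r1 - r0)"
  by (simp add: diag_block_def)

text \<open>In an entry of \<open>G * H\<close> taken at rows and columns in \<open>r0..<r1\<close>,
  the terms with \<open>l < r0\<close> vanish through \<open>G\<close> and those with
  \<open>l \<ge> r1\<close> through \<open>H\<close>; what is left is the product of the
  blocks.\<close>

lemma diag_block_mult:
  fixes G H :: "'a::field mat"
  assumes G: "G \<in> carrier_mat m m" and H: "H \<in> carrier_mat m m" and GH: "G * H = 1\<^sub>m m" and r: "r1 \<le> m"
    and G0: "\<And>i l. l < r0 \<Longrightarrow> r0 \<le> i \<Longrightarrow> i < m \<Longrightarrow> G $$ (i, l) = 0"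
    and H0: "\<And>i l. l < r1 \<Longrightarrow> r1 \<le> i \<Longrightarrow> i < m \<Longrightarrow> H $$ (i, l) = 0"
  shows "diag_block G r0 r1 * diag_block H r0 r1 = 1\<^sub>m (r1 - r0)"
proof (rule eq_matI)
  fix i j assume "i < dim_row (1\<^sub>m (r1 - r0) :: 'a mat)" "j < dim_col (1\<^sub>m (r1 - r0) :: 'a mat)"
  then have i: "i < r1 - r0" and j: "j < r1 - r0" by auto
  have "(diag_block G r0 r1 * diag_block H r0 r1) $$ (i, j) =
      (\<Sum>l<r1 - r0. G $$ (i + r0, l + r0) * H $$ (l + r0, j + r0))"
    using i j by (simp add: diag_block_def scalar_prod_def atLeast0LessThan)
  also have "\<dots> = (\<Sum>l\<in>{r0..<r1}. G $$ (i + r0, l) * H $$ (l, j + r0))"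
    by (rule sum_shift_lessThan)
  also have "\<dots> = (\<Sum>l<m. G $$ (i + r0, l) * H $$ (l, j + r0))"
  proof (rule sum.mono_neutral_left)
    show "\<forall>l\<in>{..<m} - {r0..<r1}. G $$ (i + r0, l) * H $$ (l, j + r0) = 0"
    proof
      fix l assume l: "l \<in> {..<m} - {r0..<r1}"
      show "G $$ (i + r0, l) * H $$ (l, j + r0) = 0"
      proof (cases "l < r0")
        case True
        then show ?thesis using G0[of l "i + r0"] i r by simp
      next
        case False
        then show ?thesis using H0[of "j + r0" l] l j by simp
      qed
    qed
  qed (use r in auto)
  also have "\<dots> = (G * H) $$ (i + r0, j + r0)"
    using G H i j r by (simp add: scalar_prod_def atLeast0LessThan)
  also have "\<dots> = 1\<^sub>m (r1 - r0) $$ (i, j)" unfolding GH using i j r by simp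
  finally show "(diag_block G r0 r1 * diag_block H r0 r1) $$ (i, j) = 1\<^sub>m (r1 - r0) $$ (i, j)" .
qed (simp_all add: diag_block_def)

lemma act_diag_block:
  assumes G: "G \<in> carrier_mat m m" and r: "r1 \<le> m" and i: "i < r1 - r0"
    and G0: "\<And>i l. l < r0 \<Longrightarrow> r0 \<le> i \<Longrightarrow> i < m \<Longrightarrow> G $$ (i, l) = 0"
    and y: "y \<in> low r1" and z: "\<And>l. l < r1 - r0 \<Longrightarrow> z l = y (l + r0)"
  shows "act G y (i + r0) = act (diag_block G r0 r1) z i"
proof -
  have "act (diag_block G r0 r1) z i = (\<Sum>l<r1 - r0. G $$ (i + r0, l + r0) * y (l + r0))"
    using i z by (simp add: act_def diag_block_def)
  also have "\<dots> = (\<Sum>l\<in>{r0..<r1}. G $$ (i + r0, l) * y l)" by (rule sum_shift_lessThan)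
  also have "\<dots> = (\<Sum>l<m. G $$ (i + r0, l) * y l)"
  proof (rule sum.mono_neutral_left)
    show "\<forall>l\<in>{..<m} - {r0..<r1}. G $$ (i + r0, l) * y l = 0"
    proof
      fix l assume l: "l \<in> {..<m} - {r0..<r1}"
      show "G $$ (i + r0, l) * y l = 0"
      proof (cases "l < r0")
        case True
        then show ?thesis using G0[of l "i + r0"] i r by simp
      next
        case False
        then show ?thesis using y l by (simp add: low_def)
      qed
    qed
  qed (use r in auto)
  also have "\<dots> = act G y (i + r0)" using G i r by (simp add: act_def)
  finally show ?thesis by simp
qed

lemma aci_eqI_compcol:
  assumes dims: "aci_rows N = r" "aci_cols N = c" "aci_rows N' = r" "aci_cols N' = c"
    and N: "\<And>v. v < k \<Longrightarrow> snd N v \<in> carrier_mat r c" and N': "\<And>v. v < k \<Longrightarrow> snd N' v \<in> carrier_mat r c"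
    and eq: "\<And>a j i. j < c \<Longrightarrow> i < r \<Longrightarrow> compcol k N a j i = compcol k N' a j i"
  shows "fst N = fst N'" "\<And>v. v < k \<Longrightarrow> snd N v = snd N' v"
proof -
  have e: "fst N $$ (i, j) = fst N' $$ (i, j) \<and> (\<forall>v<k. snd N v $$ (i, j) = snd N' v $$ (i, j))"
    if "i < r" "j < c" for i j
    unfolding affine_eq_iff[symmetric]
    using eq[OF that(2,1)] that dims by (simp add: compcol_eq)
  show "fst N = fst N'"
    by (rule eq_matI) (use e dims in \<open>auto simp: aci_rows_def aci_cols_def\<close>)
  show "snd N v = snd N' v" if v: "v < k" for v
    by (rule eq_matI) (use e N[OF v] N'[OF v] v in auto)
qed

lemma mult_inverse_pair:
  fixes A :: "'a::field mat"
  assumes A: "A \<in> carrier_mat m m" "B \<in> carrier_mat m m" "C \<in> carrier_mat m m" "D \<in> carrier_mat m m"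
    and BC: "B * C = 1\<^sub>m m" and AD: "A * D = 1\<^sub>m m"
  shows "(A * B) * (C * D) = 1\<^sub>m m"
proof -
  have "(A * B) * (C * D) = A * (B * (C * D))"
    by (rule assoc_mult_mat[OF A(1,2) mult_carrier_mat[OF A(3,4)]])
  also have "B * (C * D) = (B * C) * D" by (rule assoc_mult_mat[OF A(2-4), symmetric])
  also have "\<dots> = D" unfolding BC using A(4) by simp
  finally show ?thesis using AD by simp
qed

text \<open>\<open>G = R' * S\<close> passes from the \<open>R\<close>-coordinates of a column to
  its \<open>R'\<close>-coordinates. As \<open>G\<close> and its inverse \<open>H\<close> preserve
  \<open>low r0\<close> and \<open>low r1\<close>, their diagonal blocks at \<open>r0..<r1\<close>
  are inverse to each other, and that of \<open>G\<close> realises the equivalence. The bounds are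
  free so that \<open>W\<close>, \<open>S\<close> and \<open>T\<close> are instances.\<close>

lemma block_equiv:
  fixes M :: "'a::field aci"
  assumes M: "is_aci k M" and m: "m = aci_rows M" and n: "n = aci_cols M"
    and R: "R \<in> carrier_mat m m" "S \<in> carrier_mat m m" "R * S = 1\<^sub>m m" "S * R = 1\<^sub>m m"
    and R': "R' \<in> carrier_mat m m" "S' \<in> carrier_mat m m" "R' * S' = 1\<^sub>m m" "S' * R' = 1\<^sub>m m"
    and p: "p permutes {..<n}" and p': "p' permutes {..<n}"
    and r: "r1 \<le> m" and c: "c1 \<le> n"
    and G0: "\<And>x s. s \<in> {r0, r1} \<Longrightarrow> x \<in> low s \<Longrightarrow> act (R' * S) x \<in> low s"
    and H0: "\<And>x s. s \<in> {r0, r1} \<Longrightarrow> x \<in> low s \<Longrightarrow> act (R * S') x \<in> low s"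
    and pp: "p ` {..<c0} = p' ` {..<c0}" "p ` {..<c1} = p' ` {..<c1}"
    and low: "\<And>a j. j < c1 \<Longrightarrow> act R (compcol k M a (p j)) \<in> low r1"
  shows "aci_equiv k (aci_block (aci_mult R M (perm_mat n p)) r0 r1 c0 c1)
    (aci_block (aci_mult R' M (perm_mat n p')) r0 r1 c0 c1)"
proof -
  define G where "G = R' * S"
  define H where "H = R * S'"
  define N where "N = aci_mult R M (perm_mat n p)"
  define N' where "N' = aci_mult R' M (perm_mat n p')"
  define B where "B = aci_block N r0 r1 c0 c1"
  define B' where "B' = aci_block N' r0 r1 c0 c1"
  have G: "G \<in> carrier_mat m m" and H: "H \<in> carrier_mat m m" using R R' by (auto simp: G_def H_def)
  have GH: "G * H = 1\<^sub>m m" unfolding G_def H_def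
    by (rule mult_inverse_pair[OF R'(1) R(2,1) R'(2) R(4) R'(3)])
  have HG: "H * G = 1\<^sub>m m" unfolding G_def H_def
    by (rule mult_inverse_pair[OF R(1) R'(2,1) R(2) R'(4) R(3)])
  have Gz: "G $$ (i, l) = 0" if "s \<in> {r0, r1}" "l < s" "s \<le> i" "i < m" for s i l
    by (rule mat_zero_if_act_low[OF G G0[OF that(1), folded G_def] that(2-4)])
  have Hz: "H $$ (i, l) = 0" if "s \<in> {r0, r1}" "l < s" "s \<le> i" "i < m" for s i l
    by (rule mat_zero_if_act_low[OF H H0[OF that(1), folded H_def] that(2-4)])
  have D: "diag_block G r0 r1 * diag_block H r0 r1 = 1\<^sub>m (r1 - r0)"
    by (rule diag_block_mult[OF G H GH r Gz[of r0] Hz[of r1]]) simp_all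
  have D': "diag_block H r0 r1 * diag_block G r0 r1 = 1\<^sub>m (r1 - r0)"
    by (rule diag_block_mult[OF H G HG r Hz[of r0] Gz[of r1]]) simp_all
  have inv: "invertible_mat (diag_block G r0 r1)"
    by (rule invertible_matI[OF diag_block_carrier diag_block_carrier D D'])
  \<comment> \<open>The column at position \<open>j\<close> in the second arrangement stands at
    position \<open>q j\<close> in the first. Both arrangements have the same column sets before
    \<open>c0\<close> and before \<open>c1\<close>, so \<open>q\<close> maps
    \<open>{c0..<c1}\<close> to itself.\<close>
  define q where "q j = inv_into UNIV p (p' j)" for j
  have pq: "p (q j) = p' j" for j unfolding q_def using permutes_inverses(1)[OF p] .
  have injq: "inj q"
  proof (rule injI)
    fix i j assume "q i = q j"
    then have "p' i = p' j" using pq[of i] pq[of j] by simp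
    then show "i = j" using permutes_inj[OF p'] by (simp add: inj_eq)
  qed
  have qim: "q ` {..<c} = {..<c}" if "p ` {..<c} = p' ` {..<c}" for c
  proof -
    have "q ` {..<c} = inv_into UNIV p ` p ` {..<c}" unfolding that q_def by (simp add: image_image)
    also have "\<dots> = {..<c}" using permutes_inverses(2)[OF p] by (simp add: image_image)
    finally show ?thesis .
  qed
  have q1: "q j < c1 \<and> c0 \<le> q j" if "j < c1" "c0 \<le> j" for j
  proof
    have "q j \<in> q ` {..<c1}" using that(1) by simp
    then show "q j < c1" unfolding qim[OF pp(2)] by simp
    show "c0 \<le> q j"
    proof (rule ccontr)
      assume "\<not> c0 \<le> q j"
      then have "q j \<in> q ` {..<c0}" unfolding qim[OF pp(1)] by simp
      then have "j < c0" using injq by (auto simp: inj_eq)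
      then show False using that(2) by simp
    qed
  qed
  \<comment> \<open>\<open>q\<close> in the numbering of the block, continued by the identity
    because \<open>permutes\<close> fixes everything outside.\<close>
  define t where "t j = (if j < c1 - c0 then q (j + c0) - c0 else j)" for j
  have tq: "t j + c0 = q (j + c0)" "t j < c1 - c0" if "j < c1 - c0" for j
  proof -
    have "j + c0 < c1" using that by simp
    then have "q (j + c0) < c1" "c0 \<le> q (j + c0)" using q1[of "j + c0"] by auto
    then show "t j + c0 = q (j + c0)" "t j < c1 - c0" using that by (auto simp: t_def)
  qed
  have t: "t permutes {..<c1 - c0}"
  proof (rule bij_imp_permutes)
    have inj: "inj_on t {..<c1 - c0}"
    proof (rule inj_onI)
      fix i j assume ij: "i \<in> {..<c1 - c0}" "j \<in> {..<c1 - c0}" "t i = t j"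
      then have "q (i + c0) = q (j + c0)" using tq(1)[of i] tq(1)[of j] by simp
      then show "i = j" using injq by (simp add: inj_eq)
    qed
    have "t ` {..<c1 - c0} \<subseteq> {..<c1 - c0}" using tq(2) by auto
    then have "t ` {..<c1 - c0} = {..<c1 - c0}" using inj by (intro endo_inj_surj) simp_all
    then show "bij_betw t {..<c1 - c0} {..<c1 - c0}" using inj by (simp add: bij_betw_def)
  qed (simp add: t_def)
  have Mc: "\<forall>v<k. snd M v \<in> carrier_mat (aci_rows M) (aci_cols M)" using M by (simp add: is_aci_def)
  have dN: "aci_rows N = m" "aci_cols N = n" "aci_rows N' = m" "aci_cols N' = n"
    using R R' by (auto simp: N_def N'_def)
  have dB: "aci_rows B = r1 - r0" "aci_cols B = c1 - c0" "aci_rows B' = r1 - r0" "aci_cols B' = c1 - c0"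
    by (auto simp: B_def B'_def)
  have Bc: "snd B v \<in> carrier_mat (r1 - r0) (c1 - c0)" "snd B' v \<in> carrier_mat (r1 - r0) (c1 - c0)" for v
    by (auto simp: B_def B'_def aci_block_def)
  let ?E = "aci_mult (diag_block G r0 r1) B (perm_mat (c1 - c0) t)"
  have dE: "aci_rows ?E = r1 - r0" "aci_cols ?E = c1 - c0"
    by (simp_all add: aci_mult_dims(1)[OF diag_block_carrier])
  have Ec: "snd ?E v \<in> carrier_mat (r1 - r0) (c1 - c0)" for v
    unfolding aci_mult_def using diag_block_carrier[of G r0 r1]
    by (auto simp: perm_mat_def)
  have eq: "compcol k B' a j i = compcol k ?E a j i" if j: "j < c1 - c0" and i: "i < r1 - r0" for a j i
  proof -
    have jn: "j + c0 < n" using j c by simp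
    have qn: "q (j + c0) < c1" using q1[of "j + c0"] j by simp
    define x where "x = compcol k M a (p' (j + c0))"
    have x: "x \<in> low m" unfolding x_def m by (rule compcol_low)
    have Ny: "compcol k N a (q (j + c0)) = act R x"
      using compcol_aci_mult[OF Mc, of R p "q (j + c0)" a] R(1) p qn c
      by (simp add: N_def m n pq x_def)
    have y: "act R x \<in> low r1" using low[OF qn, of a] by (simp add: pq x_def)
    have "compcol k B' a j i = compcol k N' a (j + c0) (i + r0)"
      unfolding B'_def by (rule compcol_aci_block) (use dN r c i j in auto)
    also have "compcol k N' a (j + c0) = act R' x"
      using compcol_aci_mult[OF Mc, of R' p' "j + c0" a] R'(1) p' jn by (simp add: N'_def m n x_def)
    also have "act R' x = act G (act R x)"
    proof -
      have "act G (act R x) = act R' (act S (act R x))" unfolding G_def by (rule act_mult[OF R'(1) R(2), symmetric])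
      then show ?thesis by (simp add: act_inverse[OF R(1,2,4) x])
    qed
    also have "act G (act R x) (i + r0) = act (diag_block G r0 r1) (compcol k B a (t j)) i"
    proof (rule act_diag_block[OF G r i Gz[of r0] y])
      fix l assume l: "l < r1 - r0"
      have "compcol k B a (t j) l = compcol k N a (t j + c0) (l + r0)"
        unfolding B_def by (rule compcol_aci_block) (use dN r c l tq(2)[OF j] in auto)
      then show "compcol k B a (t j) l = act R x (l + r0)" by (simp add: tq(1)[OF j] Ny)
    qed simp_all
    also have "act (diag_block G r0 r1) (compcol k B a (t j)) = compcol k ?E a j"
      using compcol_aci_mult[of k B "diag_block G r0 r1" t j a] Bc diag_block_carrier[of G r0 r1] t j dB by simp
    finally show ?thesis .
  qed
  show ?thesis
    unfolding aci_equiv_def N_def[symmetric] N'_def[symmetric] B_def[symmetric] B'_def[symmetric]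
  proof (rule exI[of _ "diag_block G r0 r1"], rule exI[of _ "perm_mat (c1 - c0) t"], intro conjI allI impI)
    show "fst B' = fst ?E" by (rule aci_eqI_compcol(1)[OF dB(3,4) dE Bc(2) Ec eq])
    show "snd B' v = snd ?E v" if "v < k" for v by (rule aci_eqI_compcol(2)[OF dB(3,4) dE Bc(2) Ec eq that])
    show "is_perm_mat (aci_cols B) (perm_mat (c1 - c0) t :: 'a mat)" using t dB by (auto simp: is_perm_mat_def)
  qed (use inv dB diag_block_carrier in auto)
qed

section \<open>Existence of a chain and uniqueness of a maximal one\<close>

context column_family
begin

lemma colrank_empty: "colrank {} = 0"
  using fs.dim_le_card[of "{}" "{}"] by (simp add: colrank_def colvals_def)

lemma ex_max_deficiency:
  obtains d J0 where "\<forall>J\<subseteq>{..<n}. card J \<le> colrank J + d" "J0 \<subseteq> {..<n}" "colrank J0 + d = card J0"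
    "colrank J0 < card J0 \<or> card J0 = 0"
proof -
  \<comment> \<open>Truncated subtraction does not change the maximum, since \<open>{}\<close>
    already has deficiency zero.\<close>
  let ?D = "(\<lambda>J. card J - colrank J) ` Pow {..<n}"
  define d where "d = Max ?D"
  have fin: "finite ?D" by simp
  have ne: "?D \<noteq> {}" by blast
  have bound: "\<forall>J\<subseteq>{..<n}. card J \<le> colrank J + d"
  proof (intro allI impI)
    fix J assume "J \<subseteq> {..<n}"
    then have "card J - colrank J \<le> d" unfolding d_def by (intro Max_ge[OF fin]) simp
    then show "card J \<le> colrank J + d" by simp
  qed
  show thesis
  \<comment> \<open>For \<open>d = 0\<close> the wide part has to be void, so the minimiser is
    \<open>{}\<close>. For \<open>d > 0\<close> a set attaining the maximum has positive deficiency,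
    hence no truncation and more columns than rows.\<close>
  proof (cases "d = 0")
    case True
    show ?thesis by (rule that[OF bound, of "{}"]) (use True colrank_empty in auto)
  next
    case False
    have "d \<in> ?D" unfolding d_def by (rule Max_in[OF fin ne])
    then obtain J0 where J0: "J0 \<subseteq> {..<n}" "d = card J0 - colrank J0" by auto
    show ?thesis by (rule that[OF bound J0(1)]) (use False J0(2) in auto)
  qed
qed

lemma ex_triangular:
  obtains R p r1 r2 r3 c1 c2 c3 where "R \<in> carrier_mat m m" "invertible_mat R" "p permutes {..<n}"
    "triangular (\<lambda>a j. act R (X a (p j))) m n r1 r2 r3 c1 c2 c3"
proof -
  obtain d J0 where d: "\<forall>J\<subseteq>{..<n}. card J \<le> colrank J + d"
    and J0: "J0 \<subseteq> {..<n}" "colrank J0 + d = card J0" "colrank J0 < card J0 \<or> card J0 = 0"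
    by (rule ex_max_deficiency)
  have d': "card J \<le> colrank J + d" if "J \<subseteq> {..<n}" for J using d that by simp
  have nd: "n \<le> colrank {..<n} + d" using d'[of "{..<n}"] by simp
  show thesis
  \<comment> \<open>If \<open>n < m + d\<close>, the complement of a minimiser is tall and
    \<open>S\<close> can be void, with \<open>J1 = J2 = J0\<close>. Otherwise
    \<open>n = m + d\<close> and all columns together form a minimiser, so \<open>T\<close> is void
    and \<open>S\<close> takes the columns outside \<open>J0\<close>.\<close>
  proof (cases "n < m + d")
    case True
    have "card J0 \<le> n" using card_mono[OF _ J0(1)] by simp
    then have tall: "n - card J0 < m - colrank J0 \<or> card J0 = n \<and> colrank J0 = m" using True J0(2) by linarith
    show ?thesis
      by (rule chain_imp_triangular[OF order_refl J0(1) d' J0(2,2,3) tall]) (assumption, rule that)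
  next
    case False
    then have n: "colrank {..<n} = m" "n = m + d" using nd colrank_le[of "{..<n}"] by auto
    have eq: "colrank {..<n} + d = card {..<n}" using n by simp
    have tall: "n - card {..<n} < m - colrank {..<n} \<or> card {..<n} = n \<and> colrank {..<n} = m" using n by simp
    show ?thesis
      by (rule chain_imp_triangular[OF J0(1) order_refl d' J0(2) eq J0(3) tall]) (assumption, rule that)
  qed
qed

text \<open>Both chains consist of minimisers of \<open>colrank J - card J\<close>, which form a lattice; so \<open>J1 \<inter> K1\<close> and
  \<open>J2 \<union> K2\<close> again give a decomposition, with a square part at least as large as either given one.\<close>

lemma triangular_max_unique:
  assumes R: "R \<in> carrier_mat m m" "S \<in> carrier_mat m m" "S * R = 1\<^sub>m m" "p permutes {..<n}"
    and R': "R' \<in> carrier_mat m m" "S' \<in> carrier_mat m m" "S' * R' = 1\<^sub>m m" "p' permutes {..<n}"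
    and tri: "triangular (\<lambda>a j. act R (X a (p j))) m n r1 r2 r3 c1 c2 c3"
    and tri': "triangular (\<lambda>a j. act R' (X a (p' j))) m n r1' r2' r3' c1' c2' c3'"
    and max: "\<And>R p s1 s2 s3 d1 d2 d3. R \<in> carrier_mat m m \<Longrightarrow> invertible_mat R \<Longrightarrow> p permutes {..<n} \<Longrightarrow>
      triangular (\<lambda>a j. act R (X a (p j))) m n s1 s2 s3 d1 d2 d3 \<Longrightarrow> s2 \<le> r2 \<and> s2 \<le> r2'"
  shows "p ` {..<c1} = p' ` {..<c1'}" "p ` {..<c1 + c2} = p' ` {..<c1' + c2'}"
proof -
  define J1 where "J1 = p ` {..<c1}"
  define J2 where "J2 = p ` {..<c1 + c2}"
  define K1 where "K1 = p' ` {..<c1'}"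
  define K2 where "K2 = p' ` {..<c1' + c2'}"
  have t: "r1 + r2 + r3 = m" "c1 + c2 + c3 = n" "r1 < c1 \<or> r1 = 0 \<and> c1 = 0" "r2 = c2"
    "c3 < r3 \<or> r3 = 0 \<and> c3 = 0" using tri by (simp_all add: triangular_def)
  have t': "r1' + r2' + r3' = m" "c1' + c2' + c3' = n" "r1' < c1' \<or> r1' = 0 \<and> c1' = 0" "r2' = c2'"
    "c3' < r3' \<or> r3' = 0 \<and> c3' = 0" using tri' by (simp_all add: triangular_def)
  note ch = triangular_imp_chain[OF R tri] and ch' = triangular_imp_chain[OF R' tri']
  have inj: "inj_on p A" "inj_on p' A" for A
    using inj_on_subset[OF permutes_inj[OF R(4)]] inj_on_subset[OF permutes_inj[OF R'(4)]] by auto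
  have cards: "card J1 = c1" "card J2 = c1 + c2" "card K1 = c1'" "card K2 = c1' + c2'"
    by (simp_all add: J1_def J2_def K1_def K2_def card_image inj)
  have ranks: "colrank J1 = r1" "colrank J2 = r1 + r2" "colrank K1 = r1'" "colrank K2 = r1' + r2'"
    using ch(1,2) ch'(1,2) by (simp_all only: J1_def J2_def K1_def K2_def)
  have pn: "p ` {..<c} \<subseteq> {..<n}" "p' ` {..<c} \<subseteq> {..<n}" if "c \<le> n" for c
  proof -
    have c: "{..<c} \<subseteq> {..<n}" using that by simp
    show "p ` {..<c} \<subseteq> {..<n}" using image_mono[OF c, of p] unfolding permutes_image[OF R(4)] .
    show "p' ` {..<c} \<subseteq> {..<n}" using image_mono[OF c, of p'] unfolding permutes_image[OF R'(4)] .
  qed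
  have sub: "J1 \<subseteq> {..<n}" "J2 \<subseteq> {..<n}" "K1 \<subseteq> {..<n}" "K2 \<subseteq> {..<n}"
    unfolding J1_def J2_def K1_def K2_def by (rule pn; use t(2) t'(2) in simp)+
  have chain: "J1 \<subseteq> J2" "K1 \<subseteq> K2" by (auto simp: J1_def J2_def K1_def K2_def)
  have fin: "finite J1" "finite J2" "finite K1" "finite K2"
    by (simp_all add: J1_def J2_def K1_def K2_def)
  define d where "d = c1 - r1"
  have cd: "r1 + d = c1" using t(3) by (auto simp: d_def)
  have d: "card J \<le> colrank J + d" if "J \<subseteq> {..<n}" for J using ch(3)[OF that] cd by simp
  \<comment> \<open>In each decomposition \<open>c1 - r1\<close> bounds the deficiency of every
    column set and is attained, so it is the same number \<open>d\<close> for both.\<close>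
  have cd': "r1' + d = c1'"
    using ch'(3)[OF sub(1)] d[OF sub(3)] cards ranks cd by simp
  have lat: "colrank (A \<union> B) + d = card (A \<union> B)" "colrank (A \<inter> B) + d = card (A \<inter> B)"
    if "A \<subseteq> {..<n}" "B \<subseteq> {..<n}" "finite A" "finite B" "colrank A + d = card A" "colrank B + d = card B" for A B
  proof -
    have "A \<union> B \<subseteq> {..<n}" "A \<inter> B \<subseteq> {..<n}" using that(1,2) by auto
    then have "card (A \<union> B) \<le> colrank (A \<union> B) + d" "card (A \<inter> B) \<le> colrank (A \<inter> B) + d" by (intro d; simp)+
    then show "colrank (A \<union> B) + d = card (A \<union> B)" "colrank (A \<inter> B) + d = card (A \<inter> B)"
      using colrank_submodular[of A B] card_Un_Int[OF that(3,4)] that(5,6) by linarith+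
  qed
  have L1: "colrank (J1 \<inter> K1) + d = card (J1 \<inter> K1)"
    by (rule lat(2)) (use sub fin cards ranks cd cd' in simp_all)
  have L2: "colrank (J2 \<union> K2) + d = card (J2 \<union> K2)"
    by (rule lat(1)) (use sub fin cards ranks cd cd' t(4) t'(4) in simp_all)
  \<comment> \<open>For \<open>d = 0\<close> the wide part is void, so \<open>J1\<close> and with it
    the intersection is empty.\<close>
  have wide: "colrank (J1 \<inter> K1) < card (J1 \<inter> K1) \<or> card (J1 \<inter> K1) = 0"
  proof (cases "d = 0")
    case True
    then have "c1 = 0" using t(3) cd by auto
    then show ?thesis by (simp add: J1_def)
  qed (use L1 in auto)
  have UN: "J2 \<union> K2 \<subseteq> {..<n}" using sub by auto
  have leU: "card (J2 \<union> K2) \<le> n" using card_mono[OF _ UN] by simp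
  \<comment> \<open>Every minimiser leaves \<open>m + d - n\<close> more rows than columns. If this
    is not positive, \<open>T\<close> is void, so \<open>J2\<close> and hence the union consists of
    all columns.\<close>
  have tall: "n - card (J2 \<union> K2) < m - colrank (J2 \<union> K2) \<or>
      card (J2 \<union> K2) = n \<and> colrank (J2 \<union> K2) = m"
  proof (cases "n < m + d")
    case True
    then show ?thesis using L2 leU by linarith
  next
    case False
    then have "c3 = 0" "r3 = 0" using t cd by auto
    then have "card J2 = n" "m + d = n" using cards(2) t cd by auto
    moreover have "card J2 \<le> card (J2 \<union> K2)" using fin by (intro card_mono) auto
    ultimately show ?thesis using leU L2 by auto
  qed
  have sub12: "J1 \<inter> K1 \<subseteq> J2 \<union> K2" using chain by auto
  obtain Q q where Q: "Q \<in> carrier_mat m m" "invertible_mat Q" "q permutes {..<n}"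
    "triangular (\<lambda>a j. act Q (X a (q j))) m n (colrank (J1 \<inter> K1)) (card (J2 \<union> K2) - card (J1 \<inter> K1))
       (m - colrank (J2 \<union> K2)) (card (J1 \<inter> K1)) (card (J2 \<union> K2) - card (J1 \<inter> K1)) (n - card (J2 \<union> K2))"
    by (rule chain_imp_triangular[OF sub12 UN d L1 L2 wide tall])
  have le: "card (J2 \<union> K2) - card (J1 \<inter> K1) \<le> r2" "card (J2 \<union> K2) - card (J1 \<inter> K1) \<le> r2'"
    using max[OF Q] by auto
  have mono: "card J2 \<le> card (J2 \<union> K2)" "card K2 \<le> card (J2 \<union> K2)"
    "card (J1 \<inter> K1) \<le> card J1" "card (J1 \<inter> K1) \<le> card K1"
    using fin by (auto intro!: card_mono)
  \<comment> \<open>The merged chain has upper member at least as large and lower member at most as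
    large as in either chain, yet by maximality no larger gap; so all four cardinalities
    agree.\<close>
  have e: "card (J2 \<union> K2) = card J2" "card (J2 \<union> K2) = card K2" "card (J1 \<inter> K1) = card J1"
    "card (J1 \<inter> K1) = card K1" using le mono cards t(4) t'(4) by linarith+
  have "J2 = J2 \<union> K2" by (rule card_subset_eq) (use fin e in auto)
  moreover have "K2 = J2 \<union> K2" by (rule card_subset_eq) (use fin e in auto)
  moreover have "J1 \<inter> K1 = J1" by (rule card_subset_eq) (use fin e in auto)
  moreover have "J1 \<inter> K1 = K1" by (rule card_subset_eq) (use fin e in auto)
  ultimately have "J1 = K1" "J2 = K2" by simp_all
  then show "p ` {..<c1} = p' ` {..<c1'}" "p ` {..<c1 + c2} = p' ` {..<c1' + c2'}"
    by (simp_all only: J1_def J2_def K1_def K2_def)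
qed

text \<open>Equal leading column sets have equal values, and \<open>R\<close> and \<open>R'\<close>
  both send these into the same leading coordinates, as many as their rank. The levels
  \<open>0\<close> and \<open>m\<close> supply the outer borders of \<open>W\<close> and
  \<open>T\<close>.\<close>

lemma change_of_basis_low:
  assumes R: "R \<in> carrier_mat m m" "S \<in> carrier_mat m m" "S * R = 1\<^sub>m m" "p permutes {..<n}"
    and R': "R' \<in> carrier_mat m m"
    and tri: "triangular (\<lambda>a j. act R (X a (p j))) m n r1 r2 r3 c1 c2 c3"
    and tri': "triangular (\<lambda>a j. act R' (X a (p' j))) m n r1 r2 r3 c1 c2 c3"
    and eq: "p ` {..<c1} = p' ` {..<c1}" "p ` {..<c1 + c2} = p' ` {..<c1 + c2}"
    and s: "s \<in> {0, r1, r1 + r2, m}" "x \<in> low s"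
  shows "act (R' * S) x \<in> low s"
proof -
  have gen: "act (R' * S) x \<in> low r"
    if x: "x \<in> low r" and r: "colrank (p ` {..<c}) = r" and e: "p ` {..<c} = p' ` {..<c}"
      and l: "\<And>a j. j < c \<Longrightarrow> act R (X a (p j)) \<in> low r"
      and l': "\<And>a j. j < c \<Longrightarrow> act R' (X a (p' j)) \<in> low r" for c r
  proof (rule act_change_of_basis_low[OF R(1-3) R' colvals_low[of "p ` {..<c}"] _ _ _ x])
    show "fs.dim (colvals (p ` {..<c})) = r" using r by (simp add: colrank_def)
    show "act R z \<in> low r" if z: "z \<in> colvals (p ` {..<c})" for z
      using z l by (auto simp: colvals_def)
    show "act R' z \<in> low r" if z: "z \<in> colvals (p ` {..<c})" for z
      using z l' unfolding e by (auto simp: colvals_def)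
  qed
  note ch = triangular_imp_chain[OF R tri]
  note l = triangular_low[OF tri] and l' = triangular_low[OF tri']
  consider "s = 0" | "s = r1" | "s = r1 + r2" | "s = m" using s(1) by auto
  then show ?thesis
  proof cases
    case 1
    then have "x = 0" using s(2) by (simp add: low_def fun_eq_iff)
    then have "act (R' * S) x = 0" by (simp only: act_0)
    then show ?thesis by (simp add: low_def)
  next
    case 2
    show ?thesis unfolding 2 by (rule gen[OF s(2)[unfolded 2] ch(1) eq(1) l(1) l'(1)])
  next
    case 3
    show ?thesis unfolding 3 by (rule gen[OF s(2)[unfolded 3] ch(2) eq(2) l(2) l'(2)])
  next
    case 4
    show ?thesis unfolding 4 by (rule act_low) (use R(2) R' in simp)
  qed
qed

end

section \<open>Transfer to ACI-matrices\<close>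

lemma column_family_compcol:
  "is_aci k M \<Longrightarrow> column_family (compcol k M) (aci_rows M) (aci_cols M)"
  by unfold_locales (simp_all add: compcol_low ex_compcol_eq)

lemma block_decompE:
  assumes M: "is_aci k M" and D: "block_decomp k M R Q r1 r2 r3 c1 c2 c3"
  obtains S p where "R \<in> carrier_mat (aci_rows M) (aci_rows M)" "S \<in> carrier_mat (aci_rows M) (aci_rows M)"
    "R * S = 1\<^sub>m (aci_rows M)" "S * R = 1\<^sub>m (aci_rows M)"
    "p permutes {..<aci_cols M}" "Q = perm_mat (aci_cols M) p"
    "triangular (\<lambda>a j. act R (compcol k M a (p j))) (aci_rows M) (aci_cols M) r1 r2 r3 c1 c2 c3"
proof -
  have R: "R \<in> carrier_mat (aci_rows M) (aci_rows M)" "invertible_mat R" "is_perm_mat (aci_cols M) Q"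
    using D by (simp_all add: block_decomp_def Let_def)
  obtain p where p: "p permutes {..<aci_cols M}" "Q = perm_mat (aci_cols M) p"
    using R(3) by (auto simp: is_perm_mat_def)
  obtain S where S: "S \<in> carrier_mat (aci_rows M) (aci_rows M)" "R * S = 1\<^sub>m (aci_rows M)"
    "S * R = 1\<^sub>m (aci_rows M)"
    by (rule invertible_matE[OF R(2,1)])
  have "triangular (\<lambda>a j. act R (compcol k M a (p j))) (aci_rows M) (aci_cols M) r1 r2 r3 c1 c2 c3"
    using D block_decomp_iff_triangular[OF M refl refl R(1,2) p(1)] p(2) by simp
  then show thesis using that[OF R(1) S p] by simp
qed

lemma block_decomp_blocks_equiv:
  assumes M: "is_aci k M"
    and D: "block_decomp k M R Q r1 r2 r3 c1 c2 c3" and D': "block_decomp k M R' Q' r1' r2' r3' c1' c2' c3'"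
    and max: "\<forall>R'' Q'' s1 s2 s3 d1 d2 d3. block_decomp k M R'' Q'' s1 s2 s3 d1 d2 d3 \<longrightarrow> s2 \<le> r2"
      "\<forall>R'' Q'' s1 s2 s3 d1 d2 d3. block_decomp k M R'' Q'' s1 s2 s3 d1 d2 d3 \<longrightarrow> s2 \<le> r2'"
  shows "aci_equiv k (decomp_W M R Q r1 c1) (decomp_W M R' Q' r1' c1')"
    "aci_equiv k (decomp_S M R Q r1 r2 c1 c2) (decomp_S M R' Q' r1' r2' c1' c2')"
    "aci_equiv k (decomp_T M R Q (r1 + r2) (c1 + c2)) (decomp_T M R' Q' (r1' + r2') (c1' + c2'))"
proof -
  define m where "m = aci_rows M"
  define n where "n = aci_cols M"
  interpret column_family "compcol k M" m n unfolding m_def n_def by (rule column_family_compcol[OF M])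
  obtain S p where R: "R \<in> carrier_mat m m" "S \<in> carrier_mat m m" "R * S = 1\<^sub>m m" "S * R = 1\<^sub>m m"
    and p: "p permutes {..<n}" "Q = perm_mat n p"
    and tri: "triangular (\<lambda>a j. act R (compcol k M a (p j))) m n r1 r2 r3 c1 c2 c3"
    unfolding m_def n_def by (rule block_decompE[OF M D])
  obtain S' p' where R': "R' \<in> carrier_mat m m" "S' \<in> carrier_mat m m" "R' * S' = 1\<^sub>m m" "S' * R' = 1\<^sub>m m"
    and p': "p' permutes {..<n}" "Q' = perm_mat n p'"
    and tri': "triangular (\<lambda>a j. act R' (compcol k M a (p' j))) m n r1' r2' r3' c1' c2' c3'"
    unfolding m_def n_def by (rule block_decompE[OF M D'])
  have mx: "s2 \<le> r2 \<and> s2 \<le> r2'" if A: "A \<in> carrier_mat m m" "invertible_mat A" and q: "q permutes {..<n}"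
    and t: "triangular (\<lambda>a j. act A (compcol k M a (q j))) m n s1 s2 s3 d1 d2 d3" for A q s1 s2 s3 d1 d2 d3
  proof -
    have "block_decomp k M A (perm_mat n q) s1 s2 s3 d1 d2 d3"
      using block_decomp_iff_triangular[OF M m_def n_def A q] t by simp
    then show ?thesis using max(1)[rule_format] max(2)[rule_format] by (intro conjI)
  qed
  have J: "p ` {..<c1} = p' ` {..<c1'}" "p ` {..<c1 + c2} = p' ` {..<c1' + c2'}"
    using triangular_max_unique[OF R(1,2,4) p(1) R'(1,2,4) p'(1) tri tri' mx] by simp_all
  have inj: "inj_on p A" "inj_on p' A" for A
    using inj_on_subset[OF permutes_inj[OF p(1)]] inj_on_subset[OF permutes_inj[OF p'(1)]] by auto
  \<comment> \<open>The common column sets determine all block sizes: column numbers as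
    cardinalities, row numbers through \<open>colrank\<close>.\<close>
  have c: "c1' = c1" "c2' = c2"
    using arg_cong[OF J(1), of card] arg_cong[OF J(2), of card] by (simp_all add: card_image inj)
  have r: "r1' = r1" "r2' = r2"
    using triangular_imp_chain(1,2)[OF R(1,2,4) p(1) tri] triangular_imp_chain(1,2)[OF R'(1,2,4) p'(1) tri'] J
    by simp_all
  have sum: "r1 + r2 + r3 = m" "c1 + c2 + c3 = n" "r1' + r2' + r3' = m" "c1' + c2' + c3' = n"
    using tri tri' by (simp_all add: triangular_def)
  then have rc3: "r3' = r3" "c3' = c3" using r c by auto
  note tri' = tri'[unfolded r c rc3] and J = J[unfolded c]
  have G: "act (R' * S) x \<in> low s" if "s \<in> {0, r1, r1 + r2, m}" "x \<in> low s" for s x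
    by (rule change_of_basis_low[OF R(1,2,4) p(1) R'(1) tri tri' J that])
  have H: "act (R * S') x \<in> low s" if "s \<in> {0, r1, r1 + r2, m}" "x \<in> low s" for s x
    by (rule change_of_basis_low[OF R'(1,2,4) p'(1) R(1) tri' tri J[symmetric] that])
  have pn: "p ` {..<n} = p' ` {..<n}" using permutes_image[OF p(1)] permutes_image[OF p'(1)] by simp
  note l1 = triangular_low(1)[OF tri] and l2 = triangular_low(2)[OF tri]
  note be = block_equiv[OF M m_def n_def R R' p(1) p'(1)]
  have le: "r1 \<le> m" "r1 + r2 \<le> m" "c1 \<le> n" "c1 + c2 \<le> n" using sum by auto
  have J0: "p ` {..<0} = p' ` {..<0}" by simp
  have GW: "act (R' * S) x \<in> low s" if "s \<in> {0, r1}" "x \<in> low s" for s x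
    by (rule G) (use that in auto)
  have HW: "act (R * S') x \<in> low s" if "s \<in> {0, r1}" "x \<in> low s" for s x
    by (rule H) (use that in auto)
  show "aci_equiv k (decomp_W M R Q r1 c1) (decomp_W M R' Q' r1' c1')"
    unfolding decomp_W_def p(2) p'(2) r c by (rule be[OF le(1,3) GW HW J0 J(1) l1])
  have GS: "act (R' * S) x \<in> low s" if "s \<in> {r1, r1 + r2}" "x \<in> low s" for s x
    by (rule G) (use that in auto)
  have HS: "act (R * S') x \<in> low s" if "s \<in> {r1, r1 + r2}" "x \<in> low s" for s x
    by (rule H) (use that in auto)
  show "aci_equiv k (decomp_S M R Q r1 r2 c1 c2) (decomp_S M R' Q' r1' r2' c1' c2')"
    unfolding decomp_S_def p(2) p'(2) r c by (rule be[OF le(2,4) GS HS J(1,2) l2])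
  have GT: "act (R' * S) x \<in> low s" if "s \<in> {r1 + r2, m}" "x \<in> low s" for s x
    by (rule G) (use that in auto)
  have HT: "act (R * S') x \<in> low s" if "s \<in> {r1 + r2, m}" "x \<in> low s" for s x
    by (rule H) (use that in auto)
  show "aci_equiv k (decomp_T M R Q (r1 + r2) (c1 + c2)) (decomp_T M R' Q' (r1' + r2') (c1' + c2'))"
    unfolding decomp_T_def p(2) p'(2) r c m_def[symmetric] n_def[symmetric]
    by (rule be[OF order_refl order_refl GT HT J(2) pn act_low[OF R(1)]])
qed

lemma ex_block_decomp:
  assumes M: "is_aci k M"
  shows "\<exists>R Q r1 r2 r3 c1 c2 c3. block_decomp k M R Q r1 r2 r3 c1 c2 c3"
proof -
  interpret column_family "compcol k M" "aci_rows M" "aci_cols M" by (rule column_family_compcol[OF M])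
  obtain R p r1 r2 r3 c1 c2 c3 where R: "R \<in> carrier_mat (aci_rows M) (aci_rows M)" "invertible_mat R"
    "p permutes {..<aci_cols M}"
    and tri: "triangular (\<lambda>a j. act R (compcol k M a (p j))) (aci_rows M) (aci_cols M) r1 r2 r3 c1 c2 c3"
    by (rule ex_triangular)
  have "block_decomp k M R (perm_mat (aci_cols M) p) r1 r2 r3 c1 c2 c3"
    using block_decomp_iff_triangular[OF M refl refl R] tri by simp
  then show ?thesis by blast
qed

theorem theorem6p1:
  fixes k :: nat and M :: "'a::field aci"
  assumes "is_aci k M"
  shows "(\<exists>R Q r1 r2 r3 c1 c2 c3. block_decomp k M R Q r1 r2 r3 c1 c2 c3) \<and>
    (\<forall>R Q r1 r2 r3 c1 c2 c3 R' Q' r1' r2' r3' c1' c2' c3'.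
       block_decomp k M R Q r1 r2 r3 c1 c2 c3 \<and>
       (\<forall>R'' Q'' s1 s2 s3 d1 d2 d3. block_decomp k M R'' Q'' s1 s2 s3 d1 d2 d3 \<longrightarrow> s2 \<le> r2) \<and>
       block_decomp k M R' Q' r1' r2' r3' c1' c2' c3' \<and>
       (\<forall>R'' Q'' s1 s2 s3 d1 d2 d3. block_decomp k M R'' Q'' s1 s2 s3 d1 d2 d3 \<longrightarrow> s2 \<le> r2')
       \<longrightarrow>
       aci_equiv k (decomp_W M R Q r1 c1) (decomp_W M R' Q' r1' c1') \<and>
       aci_equiv k (decomp_S M R Q r1 r2 c1 c2) (decomp_S M R' Q' r1' r2' c1' c2') \<and>
       aci_equiv k (decomp_T M R Q (r1 + r2) (c1 + c2)) (decomp_T M R' Q' (r1' + r2') (c1' + c2')))"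
proof (rule conjI[OF ex_block_decomp[OF assms]], intro allI impI, elim conjE)
  fix R Q r1 r2 r3 c1 c2 c3 R' Q' r1' r2' r3' c1' c2' c3'
  assume D: "block_decomp k M R Q r1 r2 r3 c1 c2 c3"
    and max: "\<forall>R'' Q'' s1 s2 s3 d1 d2 d3. block_decomp k M R'' Q'' s1 s2 s3 d1 d2 d3 \<longrightarrow> s2 \<le> r2"
    and D': "block_decomp k M R' Q' r1' r2' r3' c1' c2' c3'"
    and max': "\<forall>R'' Q'' s1 s2 s3 d1 d2 d3. block_decomp k M R'' Q'' s1 s2 s3 d1 d2 d3 \<longrightarrow> s2 \<le> r2'"
  show "aci_equiv k (decomp_W M R Q r1 c1) (decomp_W M R' Q' r1' c1') \<and>
       aci_equiv k (decomp_S M R Q r1 r2 c1 c2) (decomp_S M R' Q' r1' r2' c1' c2') \<and>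
       aci_equiv k (decomp_T M R Q (r1 + r2) (c1 + c2)) (decomp_T M R' Q' (r1' + r2') (c1' + c2'))"
    by (intro conjI block_decomp_blocks_equiv[OF assms D D' max max'])
qed

end
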